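(* There is an enumeration algorithm that lists all defensive alliances of a given graph $G$ with polynomial delay and in polynomial space.
   Context: Graphs are finite, simple and undirected. For $G=(V,E)$, $X\subseteq V$ and $v\in V$, $\deg_X(v)$ is the number of neighbors of $v$ in $X$, and $\overline{X}=V\setminus X$. A set $A\subseteq V$ is a defensive alliance if $\deg_A(v)+1\ge \deg_{\overline{A}}(v)$ for every $v\in A$. An enumeration algorithm (which outputs every solution exactly once) has polynomial delay if the time before the first output, between any two consecutive outputs, and between the last output and termination is bounded by a polynomial in the input size. Polynomial space means that the working memory is polynomial in the input size. *)

theory Defs
  imports
    "HOL-Computational_Algebra.Polynomial"
    "HOL-Library.Log_Nat"
begin

section \<open>Graphs and defensive alliances\<close>

definition simple_graph :: "'a set \<Rightarrow> 'a set set \<Rightarrow> bool" where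
  "simple_graph V E \<longleftrightarrow> finite V \<and> (\<forall>e\<in>E. e \<subseteq> V \<and> card e = 2)"

definition deg_in :: "'a set set \<Rightarrow> 'a set \<Rightarrow> 'a \<Rightarrow> nat" where
  "deg_in E X v = card {u \<in> X. {u, v} \<in> E}"

definition defensive_alliance :: "'a set \<Rightarrow> 'a set set \<Rightarrow> 'a set \<Rightarrow> bool" where
  "defensive_alliance V E A \<longleftrightarrow>
     A \<subseteq> V \<and> (\<forall>v\<in>A. deg_in E A v + 1 \<ge> deg_in E (V - A) v)"

section \<open>Random access machines under the logarithmic cost criterion\<close>

text \<open>
  The model of computation is a random access machine with a write-only output stream. It has
  registers, which a program addresses by constants, and a memory, which it addresses indirectly;
  both hold natural numbers of unbounded size. Time and space are therefore measured in bits
  (logarithmic cost), where \<^term>\<open>floorlog 2 k\<close> is the number of binary digits of \<^term>\<open>k\<close>.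
  Up to polynomial factors this is Turing machine time and space.
\<close>

record state =
  reg :: "nat \<Rightarrow> nat"
  mem :: "nat \<Rightarrow> nat"

datatype instr =
    Const nat nat
  | Move nat nat
  | Add nat nat nat
  | Sub nat nat nat
  | Mul nat nat nat
  | Load nat nat
  | Store nat nat
  | Write nat
  | EndSolution

fun effect :: "instr \<Rightarrow> state \<Rightarrow> state" where
  "effect (Const x k) s = s\<lparr>reg := (reg s)(x := k)\<rparr>"
| "effect (Move x y) s = s\<lparr>reg := (reg s)(x := reg s y)\<rparr>"
| "effect (Add x y z) s = s\<lparr>reg := (reg s)(x := reg s y + reg s z)\<rparr>"
| "effect (Sub x y z) s = s\<lparr>reg := (reg s)(x := reg s y - reg s z)\<rparr>"
| "effect (Mul x y z) s = s\<lparr>reg := (reg s)(x := reg s y * reg s z)\<rparr>"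
| "effect (Load x y) s = s\<lparr>reg := (reg s)(x := mem s (reg s y))\<rparr>"
| "effect (Store x y) s = s\<lparr>mem := (mem s)(reg s x := reg s y)\<rparr>"
| "effect (Write x) s = s"
| "effect EndSolution s = s"

fun cost :: "instr \<Rightarrow> state \<Rightarrow> nat" where
  "cost (Const x k) s = 1 + floorlog 2 k"
| "cost (Move x y) s = 1 + floorlog 2 (reg s y)"
| "cost (Add x y z) s = 1 + floorlog 2 (reg s y) + floorlog 2 (reg s z)"
| "cost (Sub x y z) s = 1 + floorlog 2 (reg s y) + floorlog 2 (reg s z)"
| "cost (Mul x y z) s = 1 + floorlog 2 (reg s y) + floorlog 2 (reg s z)"
| "cost (Load x y) s = 1 + floorlog 2 (reg s y) + floorlog 2 (mem s (reg s y))"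
| "cost (Store x y) s = 1 + floorlog 2 (reg s x) + floorlog 2 (reg s y)"
| "cost (Write x) s = 1 + floorlog 2 (reg s x)"
| "cost EndSolution s = 1"

text \<open>
  The space occupied by a state is the total length of the list of all pairs of an address and
  its nonzero content. In reachable states the sums range over finite sets, see
  \<open>exec_finite_support\<close> below.
\<close>

definition state_size :: "state \<Rightarrow> nat" where
  "state_size s = (\<Sum>x | reg s x \<noteq> 0. 1 + floorlog 2 x + floorlog 2 (reg s x))
           + (\<Sum>a | mem s a \<noteq> 0. 1 + floorlog 2 a + floorlog 2 (mem s a))"

text \<open>
  A run leaves a trace. \<^term>\<open>Work t m\<close> is a step that takes time \<^term>\<open>t\<close> and leads to a state
  of space \<^term>\<open>m\<close>; \<^term>\<open>Emit (Some k)\<close> writes the number \<^term>\<open>k\<close> to the output stream, and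
  \<^term>\<open>Emit None\<close> writes the marker that completes the output of one solution.
\<close>

datatype event = Work nat nat | Emit "nat option"

fun emitted :: "instr \<Rightarrow> state \<Rightarrow> event list" where
  "emitted (Write x) s = [Emit (Some (reg s x))]"
| "emitted EndSolution s = [Emit None]"
| "emitted _ s = []"

text \<open>\<open>IfLess x y\<close> and \<open>WhileLess x y\<close> compare the contents of the registers \<open>x\<close> and \<open>y\<close>.\<close>

datatype prog =
    Skip
  | Instr instr
  | Seq prog prog
  | IfLess nat nat prog prog
  | WhileLess nat nat prog

definition test_event :: "nat \<Rightarrow> nat \<Rightarrow> state \<Rightarrow> event" where
  "test_event x y s = Work (1 + floorlog 2 (reg s x) + floorlog 2 (reg s y)) (state_size s)"

inductive exec :: "prog \<Rightarrow> state \<Rightarrow> event list \<Rightarrow> state \<Rightarrow> bool" where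
  Skip: "exec Skip s [] s"
| Instr: "exec (Instr i) s (Work (cost i s) (state_size (effect i s)) # emitted i s) (effect i s)"
| Seq: "exec P s tr s' \<Longrightarrow> exec Q s' tr' s'' \<Longrightarrow> exec (Seq P Q) s (tr @ tr') s''"
| IfTrue: "reg s x < reg s y \<Longrightarrow> exec P s tr s' \<Longrightarrow>
    exec (IfLess x y P Q) s (test_event x y s # tr) s'"
| IfFalse: "\<not> reg s x < reg s y \<Longrightarrow> exec Q s tr s' \<Longrightarrow>
    exec (IfLess x y P Q) s (test_event x y s # tr) s'"
| WhileFalse: "\<not> reg s x < reg s y \<Longrightarrow> exec (WhileLess x y P) s [test_event x y s] s"
| WhileTrue: "reg s x < reg s y \<Longrightarrow> exec P s tr s' \<Longrightarrow> exec (WhileLess x y P) s' tr' s'' \<Longrightarrow>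
    exec (WhileLess x y P) s (test_event x y s # tr @ tr') s''"

lemma exec_deterministic:
  "exec P s tr s' \<Longrightarrow> exec P s tr2 s2 \<Longrightarrow> tr2 = tr \<and> s2 = s'"
proof (induction arbitrary: tr2 s2 rule: exec.induct)
  case (Skip s)
  then show ?case by (auto elim: exec.cases)
next
  case (Instr i s)
  then show ?case by (auto elim: exec.cases)
next
  case (Seq P s tr s' Q tr' s'')
  from Seq.prems show ?case
    by (cases rule: exec.cases) (use Seq.IH in blast)
next
  case (IfTrue s x y P tr s' Q)
  from IfTrue.prems show ?case
    by (cases rule: exec.cases) (use IfTrue.IH IfTrue.hyps in blast)+
next
  case (IfFalse s x y Q tr s' P)
  from IfFalse.prems show ?case
    by (cases rule: exec.cases) (use IfFalse.IH IfFalse.hyps in blast)+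
next
  case (WhileFalse s x y P)
  from WhileFalse.prems show ?case
    by (cases rule: exec.cases) (use WhileFalse.hyps in auto)
next
  case (WhileTrue s x y P tr s' tr' s'')
  from WhileTrue.prems show ?case
    by (cases rule: exec.cases) (use WhileTrue.IH WhileTrue.hyps in blast)+
qed

text \<open>The input word is placed in memory from address 0 on.\<close>

definition init_state :: "nat list \<Rightarrow> state" where
  "init_state w = \<lparr>reg = (\<lambda>_. 0), mem = (\<lambda>a. if a < length w then w ! a else 0)\<rparr>"

definition input_size :: "nat list \<Rightarrow> nat" where
  "input_size w = (\<Sum>k\<leftarrow>w. 1 + floorlog 2 k)"

definition finite_support :: "state \<Rightarrow> bool" where
  "finite_support s \<longleftrightarrow> finite {x. reg s x \<noteq> 0} \<and> finite {a. mem s a \<noteq> 0}"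

lemma finite_support_init: "finite_support (init_state w)"
  by (auto simp: finite_support_def init_state_def)

lemma finite_support_effect: "finite_support s \<Longrightarrow> finite_support (effect i s)"
proof -
  have upd: "finite {x. 0 < (f(a := b)) x}" if "finite {x. 0 < f x}" for f :: "nat \<Rightarrow> nat" and a b
    by (rule finite_subset[of _ "insert a {x. 0 < f x}"]) (use that in auto)
  show "finite_support s \<Longrightarrow> finite_support (effect i s)"
    by (cases i) (auto simp: finite_support_def simp del: fun_upd_apply intro: upd)
qed

lemma exec_finite_support: "exec P s tr s' \<Longrightarrow> finite_support s \<Longrightarrow> finite_support s'"
  by (induction rule: exec.induct) (auto intro: finite_support_effect)

section \<open>Enumeration algorithms\<close>

text \<open>
  An enumeration problem is given by a set \<open>I\<close> of instances, an encoding \<open>enc\<close> of instances as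
  input words, and the set \<open>sol x\<close> of the solutions of an instance \<open>x\<close>, encoded as output words.
\<close>

definition output_stream :: "event list \<Rightarrow> nat option list" where
  "output_stream tr = concat (map (\<lambda>e. case e of Work t m \<Rightarrow> [] | Emit v \<Rightarrow> [v]) tr)"

definition outputs_exactly_once :: "event list \<Rightarrow> nat list set \<Rightarrow> bool" where
  "outputs_exactly_once tr S \<longleftrightarrow>
     (\<exists>ws. output_stream tr = concat (map (\<lambda>w. map Some w @ [None]) ws) \<and> distinct ws \<and> set ws = S)"

definition enumerates ::
  "prog \<Rightarrow> 'i set \<Rightarrow> ('i \<Rightarrow> nat list) \<Rightarrow> ('i \<Rightarrow> nat list set) \<Rightarrow> bool" where
  "enumerates P I enc sol \<longleftrightarrow>
     (\<forall>x\<in>I. \<exists>tr s. exec P (init_state (enc x)) tr s \<and> outputs_exactly_once tr (sol x))"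

definition run_time :: "event list \<Rightarrow> nat" where
  "run_time tr = (\<Sum>e\<leftarrow>tr. case e of Work t m \<Rightarrow> t | Emit v \<Rightarrow> 0)"

text \<open>
  A part of the trace in which no solution is completed lies before the first output, between two
  consecutive outputs, or after the last output, and each of these three kinds of periods is such
  a part.
\<close>

definition delay_at_most :: "event list \<Rightarrow> nat \<Rightarrow> bool" where
  "delay_at_most tr d \<longleftrightarrow>
     (\<forall>us vs ws. tr = us @ vs @ ws \<and> Emit None \<notin> set vs \<longrightarrow> run_time vs \<le> d)"

definition polynomial_delay :: "prog \<Rightarrow> 'i set \<Rightarrow> ('i \<Rightarrow> nat list) \<Rightarrow> bool" where
  "polynomial_delay P I enc \<longleftrightarrow>
     (\<exists>p :: nat poly. \<forall>x\<in>I. \<exists>tr s. exec P (init_state (enc x)) tr s \<and>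
        delay_at_most tr (poly p (input_size (enc x))))"

definition polynomial_space :: "prog \<Rightarrow> 'i set \<Rightarrow> ('i \<Rightarrow> nat list) \<Rightarrow> bool" where
  "polynomial_space P I enc \<longleftrightarrow>
     (\<exists>p :: nat poly. \<forall>x\<in>I. \<exists>tr s. exec P (init_state (enc x)) tr s \<and>
        state_size (init_state (enc x)) \<le> poly p (input_size (enc x)) \<and>
        (\<forall>t m. Work t m \<in> set tr \<longrightarrow> m \<le> poly p (input_size (enc x))))"

section \<open>Listing defensive alliances\<close>

text \<open>
  An instance is a graph whose vertices are given in an arbitrary order \<open>vs\<close>. It is encoded by the
  number of vertices and the adjacency matrix, row by row, and a set of vertices is encoded by the
  increasing list of the positions of its elements in \<open>vs\<close>. The vertices are natural numbers so
  that a single program is claimed to work for all graphs: a type variable would be fixed outside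
  the existential quantifier over programs.
\<close>

definition graph_instances :: "(nat list \<times> nat set set) set" where
  "graph_instances = {(vs, E). distinct vs \<and> simple_graph (set vs) E}"

definition encode_graph :: "nat list \<times> nat set set \<Rightarrow> nat list" where
  "encode_graph = (\<lambda>(vs, E). length vs # [if {u, v} \<in> E then 1 else 0. u \<leftarrow> vs, v \<leftarrow> vs])"

definition encode_vertex_set :: "nat list \<Rightarrow> nat set \<Rightarrow> nat list" where
  "encode_vertex_set vs A = filter (\<lambda>i. vs ! i \<in> A) [0..<length vs]"

lemma inj_on_encode_vertex_set: "inj_on (encode_vertex_set vs) (Pow (set vs))"
proof (rule inj_onI)
  fix A B assume "A \<in> Pow (set vs)" "B \<in> Pow (set vs)"
    and eq: "encode_vertex_set vs A = encode_vertex_set vs B"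
  have "(\<lambda>i. vs ! i) ` set (encode_vertex_set vs C) = C" if "C \<in> Pow (set vs)" for C
    using that by (fastforce simp: encode_vertex_set_def image_iff in_set_conv_nth)
  with eq show "A = B"
    using \<open>A \<in> Pow (set vs)\<close> \<open>B \<in> Pow (set vs)\<close> by metis
qed

definition defensive_alliances :: "nat list \<times> nat set set \<Rightarrow> nat list set" where
  "defensive_alliances = (\<lambda>(vs, E). encode_vertex_set vs ` {A. defensive_alliance (set vs) E A})"

end

theory Submission
  imports Defs
begin

text \<open>
  Defensive alliances are closed under union, so among those contained in a set \<open>X\<close> there is a
  largest one, the core of \<open>X\<close>, and it is found by repeatedly removing undefended vertices from
  \<open>X\<close>. The program lists the alliances in decreasing lexicographic order of their characteristic
  vectors, starting with the set of all vertices. The successor of \<open>A\<close> is found without backtracking: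
  for the largest position \<open>i \<in> A\<close> for which this is possible, keep \<open>A\<close> below \<open>i\<close>, drop \<open>i\<close>, and
  take the core of what remains when all later positions are allowed. It has to contain the part
  of \<open>A\<close> below \<open>i\<close>. So only two characteristic vectors have to be stored, and the time between two
  outputs is that of \<open>n\<close> core computations.
\<close>

section \<open>Bounded runs\<close>

text \<open>The listing order turns inclusion into order: a proper subset always comes later. An
  alliance that first differs from \<open>A\<close> at \<open>i\<close> lies in the set whose core
  is taken, hence in the core itself. So the test on the part below \<open>i\<close> decides exactly
  whether such an alliance exists, and if so, the core is the first of them. Among the sets after
  \<open>A\<close>, a larger position of the first difference means an earlier place in the list,
  which is why the largest \<open>i\<close> is taken. The formal difficulty is the cost, since
  numbers are charged by length and the number of outputs may be exponential. All inner loops make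
  at most \<open>n\<close> rounds, so a syntactic bound on the trace length is polynomial, and all
  numbers stay at most \<open>limit n\<close>, which bounds the time of each step and the size of
  each state. Only the main loop needs a separate argument.\<close>

definition bounded :: "nat \<Rightarrow> state \<Rightarrow> bool" where
  "bounded b s \<longleftrightarrow> (\<forall>x. reg s x \<le> b \<and> mem s x \<le> b) \<and> (\<forall>x>b. reg s x = 0 \<and> mem s x = 0)"

text \<open>The constants are those of a state bounded by \<open>b\<close>: an instruction pays for
  at most two numbers, and the two sums of \<open>state_size\<close> have at most
  \<open>b + 1\<close> terms each.\<close>

definition small :: "nat \<Rightarrow> event \<Rightarrow> bool" where
  "small b e = (case e of Work t m \<Rightarrow> t \<le> 1 + 2 * b \<and> m \<le> 2 * (b + 1) * (1 + 2 * b) | Emit v \<Rightarrow> True)"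

lemma small_Emit [simp]: "small b (Emit v)"
  by (simp add: small_def)

text \<open>Bit lengths may be replaced by the numbers themselves, since the program only holds
  numbers polynomial in \<open>n\<close>.\<close>

lemma floorlog_le: "floorlog 2 k \<le> k"
proof (cases "k = 0")
  case False
  then have "2 ^ (floorlog 2 k - 1) \<le> k"
    using floorlog_bounds[of k 2] by simp
  moreover have "floorlog 2 k - 1 < 2 ^ (floorlog 2 k - 1)"
    by (rule less_exp)
  ultimately show ?thesis
    by linarith
qed (simp add: floorlog_def)

lemma support_size_le:
  fixes f :: "nat \<Rightarrow> nat"
  assumes "\<And>x. f x \<le> b" and "\<And>x. x > b \<Longrightarrow> f x = 0"
  shows "(\<Sum>x | f x \<noteq> 0. 1 + floorlog 2 x + floorlog 2 (f x)) \<le> (b + 1) * (1 + 2 * b)"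
proof -
  have sub: "{x. f x \<noteq> 0} \<subseteq> {..b}"
    using assms(2) by (auto simp: not_less[symmetric])
  have "(\<Sum>x | f x \<noteq> 0. 1 + floorlog 2 x + floorlog 2 (f x)) \<le> (\<Sum>x | f x \<noteq> 0. 1 + 2 * b)"
  proof (rule sum_mono)
    fix x assume "x \<in> {x. f x \<noteq> 0}"
    with sub have "x \<le> b" by auto
    with assms(1)[of x] show "1 + floorlog 2 x + floorlog 2 (f x) \<le> 1 + 2 * b"
      using floorlog_le[of x] floorlog_le[of "f x"] by linarith
  qed
  also have "\<dots> = card {x. f x \<noteq> 0} * (1 + 2 * b)"
    by simp
  also have "\<dots> \<le> (b + 1) * (1 + 2 * b)"
    using card_mono[OF _ sub] by (intro mult_right_mono) auto
  finally show ?thesis .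
qed

lemma bounded_state_size: "bounded b s \<Longrightarrow> state_size s \<le> 2 * (b + 1) * (1 + 2 * b)"
  using support_size_le[of "reg s" b] support_size_le[of "mem s" b]
  unfolding bounded_def state_size_def by (simp add: algebra_simps)

lemma bounded_floorlog:
  assumes "bounded b s"
  shows "floorlog 2 (reg s x) \<le> b" and "floorlog 2 (mem s x) \<le> b"
  using assms floorlog_le[of "reg s x"] floorlog_le[of "mem s x"]
  unfolding bounded_def by (metis le_trans)+

lemma small_test: "bounded b s \<Longrightarrow> small b (test_event x y s)"
  using bounded_floorlog(1)[of b s x] bounded_floorlog(1)[of b s y] bounded_state_size[of b s]
  by (simp add: small_def test_event_def)

text \<open>Only a new register index, a constant, a sum or a product can exceed the bound.
  \<open>Store\<close> is harmless because its address and its value are register contents.\<close>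

fun fits :: "nat \<Rightarrow> instr \<Rightarrow> state \<Rightarrow> bool" where
  "fits b (Const x k) s \<longleftrightarrow> x \<le> b \<and> k \<le> b"
| "fits b (Move x y) s \<longleftrightarrow> x \<le> b"
| "fits b (Add x y z) s \<longleftrightarrow> x \<le> b \<and> reg s y + reg s z \<le> b"
| "fits b (Sub x y z) s \<longleftrightarrow> x \<le> b"
| "fits b (Mul x y z) s \<longleftrightarrow> x \<le> b \<and> reg s y * reg s z \<le> b"
| "fits b (Load x y) s \<longleftrightarrow> x \<le> b"
| "fits b _ s \<longleftrightarrow> True"

lemma bounded_effect: "bounded b s \<Longrightarrow> fits b i s \<Longrightarrow> bounded b (effect i s)"
proof (cases i)
  case (Store x y)
  assume "bounded b s"
  then show ?thesis
    unfolding bounded_def Store effect.simps by (auto simp: not_less[symmetric])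
qed (auto simp: bounded_def intro: le_trans[OF diff_le_self])

lemma small_cost:
  assumes "bounded b s" and "fits b i s"
  shows "small b (Work (cost i s) (state_size (effect i s)))"
proof -
  note * = bounded_floorlog[OF assms(1)]
  have "cost i s \<le> 1 + 2 * b"
  proof (cases i)
    case (Const x k)
    then show ?thesis using assms(2) floorlog_le[of k] by auto
  next
    case (Load x y)
    then show ?thesis using *(1)[of y] *(2)[of "reg s y"] by simp
  qed (simp_all add: * mult_2 add_mono trans_le_add1)
  then show ?thesis
    using bounded_state_size[OF bounded_effect[OF assms]] by (simp add: small_def)
qed

lemma output_stream_simps [simp]:
  "output_stream [] = []"
  "output_stream (Work t m # tr) = output_stream tr"
  "output_stream (Emit v # tr) = v # output_stream tr"
  "output_stream (test_event x y s # tr) = output_stream tr"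
  "output_stream (tr @ tr') = output_stream tr @ output_stream tr'"
  by (simp_all add: output_stream_def test_event_def)

lemma run_time_simps [simp]:
  "run_time [] = 0"
  "run_time (Emit v # tr) = run_time tr"
  "run_time (tr @ tr') = run_time tr + run_time tr'"
  by (simp_all add: run_time_def)

lemma run_time_le: "\<forall>e\<in>set tr. small b e \<Longrightarrow> run_time tr \<le> length tr * (1 + 2 * b)"
  by (induction tr) (auto simp: run_time_def small_def split: event.splits)

section \<open>A weakest precondition calculus\<close>

text \<open>A syntactic frame: counters and constants held outside this set survive a run.\<close>

fun writes :: "prog \<Rightarrow> nat set" where
  "writes Skip = {}"
| "writes (Instr (Const x k)) = {x}"
| "writes (Instr (Move x y)) = {x}"
| "writes (Instr (Add x y z)) = {x}"
| "writes (Instr (Sub x y z)) = {x}"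
| "writes (Instr (Mul x y z)) = {x}"
| "writes (Instr (Load x y)) = {x}"
| "writes (Instr _) = {}"
| "writes (Seq P Q) = writes P \<union> writes Q"
| "writes (IfLess x y P Q) = writes P \<union> writes Q"
| "writes (WhileLess x y P) = writes P"

text \<open>Bounds the length of a trace in which no loop makes more than \<open>n\<close> rounds.\<close>

fun steps :: "nat \<Rightarrow> prog \<Rightarrow> nat" where
  "steps n Skip = 0"
| "steps n (Instr i) = 2"
| "steps n (Seq P Q) = steps n P + steps n Q"
| "steps n (IfLess x y P Q) = 1 + steps n P + steps n Q"
| "steps n (WhileLess x y P) = n * (1 + steps n P) + 1"

text \<open>Each loop contributes one factor \<open>n\<close>, so the degree is at most the nesting
  depth of loops.\<close>

lemma steps_poly: "\<exists>p. \<forall>n. steps n P = poly p n"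
proof (induction P)
  case Skip
  show ?case by (rule exI[of _ 0]) simp
next
  case (Instr i)
  show ?case by (rule exI[of _ "[:2:]"]) simp
next
  case (Seq P Q)
  then obtain p q where "\<forall>n. steps n P = poly p n" "\<forall>n. steps n Q = poly q n" by auto
  then show ?case by (intro exI[of _ "p + q"]) simp
next
  case (IfLess x y P Q)
  then obtain p q where "\<forall>n. steps n P = poly p n" "\<forall>n. steps n Q = poly q n" by auto
  then show ?case by (intro exI[of _ "1 + p + q"]) simp
next
  case (WhileLess x y P)
  then obtain p where "\<forall>n. steps n P = poly p n" by auto
  then show ?case by (intro exI[of _ "[:0, 1:] * (1 + p) + 1"]) simp
qed

text \<open>Quadratic because the matrix occupies \<open>n * n\<close> cells; two vectors of length
  \<open>n\<close> follow it. The 20 covers all register indices and absorbs additive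
  constants.\<close>

definition limit :: "nat \<Rightarrow> nat" where
  "limit n = (n + 20) ^ 2"

lemma le_limit: "x \<le> 20 \<Longrightarrow> x \<le> limit n"
  by (simp add: limit_def power2_eq_square algebra_simps)

text \<open>The last argument of \<open>Q\<close> is the output stream, \<open>out\<close> the part of it produced before.\<close>

definition wp ::
  "nat \<Rightarrow> prog \<Rightarrow> (state \<Rightarrow> nat option list \<Rightarrow> bool) \<Rightarrow> state \<Rightarrow> nat option list \<Rightarrow> bool" where
  "wp n P Q s out \<longleftrightarrow> (bounded (limit n) s \<longrightarrow>
     (\<exists>tr s'. exec P s tr s' \<and> length tr \<le> steps n P \<and> (\<forall>e\<in>set tr. small (limit n) e) \<and>
        bounded (limit n) s' \<and> (\<forall>x. x \<notin> writes P \<longrightarrow> reg s' x = reg s x) \<and>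
        Q s' (out @ output_stream tr)))"

lemma wp_Skip: "Q s out \<Longrightarrow> wp n Skip Q s out"
  unfolding wp_def by (auto intro!: exI[of _ "[]"] exec.Skip)

lemma wp_Instr:
  assumes "fits (limit n) i s" and "Q (effect i s) (out @ output_stream (emitted i s))"
  shows "wp n (Instr i) Q s out"
  unfolding wp_def
proof (intro impI exI conjI)
  assume b: "bounded (limit n) s"
  show "exec (Instr i) s (Work (cost i s) (state_size (effect i s)) # emitted i s) (effect i s)"
    by (rule exec.Instr)
  show "length (Work (cost i s) (state_size (effect i s)) # emitted i s) \<le> steps n (Instr i)"
    by (cases i) auto
  show "\<forall>e\<in>set (Work (cost i s) (state_size (effect i s)) # emitted i s). small (limit n) e"
    using small_cost[OF b assms(1)] by (cases i) auto
  show "bounded (limit n) (effect i s)"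
    by (rule bounded_effect[OF b assms(1)])
  show "\<forall>x. x \<notin> writes (Instr i) \<longrightarrow> reg (effect i s) x = reg s x"
    by (cases i) auto
  show "Q (effect i s) (out @ output_stream (Work (cost i s) (state_size (effect i s)) # emitted i s))"
    using assms(2) by simp
qed

lemma wp_Seq:
  assumes "wp n P (wp n R Q) s out"
  shows "wp n (Seq P R) Q s out"
  unfolding wp_def
proof
  assume "bounded (limit n) s"
  with assms obtain tr s' where 1: "exec P s tr s'" "length tr \<le> steps n P"
    "\<forall>e\<in>set tr. small (limit n) e" "bounded (limit n) s'"
    "\<forall>x. x \<notin> writes P \<longrightarrow> reg s' x = reg s x" "wp n R Q s' (out @ output_stream tr)"
    unfolding wp_def[of n P] by blast
  then obtain tr' s'' where 2: "exec R s' tr' s''" "length tr' \<le> steps n R"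
    "\<forall>e\<in>set tr'. small (limit n) e" "bounded (limit n) s''"
    "\<forall>x. x \<notin> writes R \<longrightarrow> reg s'' x = reg s' x" "Q s'' ((out @ output_stream tr) @ output_stream tr')"
    unfolding wp_def[of n R] by blast
  show "\<exists>tr s'. exec (Seq P R) s tr s' \<and> length tr \<le> steps n (Seq P R) \<and>
      (\<forall>e\<in>set tr. small (limit n) e) \<and> bounded (limit n) s' \<and>
      (\<forall>x. x \<notin> writes (Seq P R) \<longrightarrow> reg s' x = reg s x) \<and> Q s' (out @ output_stream tr)"
    by (intro exI[of _ "tr @ tr'"] exI[of _ s''] conjI exec.Seq[OF 1(1) 2(1)]) (use 1 2 in auto)
qed

lemma wp_If:
  assumes "reg s x < reg s y \<Longrightarrow> wp n P Q s out" and "\<not> reg s x < reg s y \<Longrightarrow> wp n R Q s out"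
  shows "wp n (IfLess x y P R) Q s out"
proof (cases "reg s x < reg s y")
  case True
  show ?thesis unfolding wp_def
  proof
    assume b: "bounded (limit n) s"
    with assms(1)[OF True] obtain tr s' where *: "exec P s tr s'" "length tr \<le> steps n P"
      "\<forall>e\<in>set tr. small (limit n) e" "bounded (limit n) s'"
      "\<forall>x. x \<notin> writes P \<longrightarrow> reg s' x = reg s x" "Q s' (out @ output_stream tr)"
      unfolding wp_def by blast
    show "\<exists>tr s'. exec (IfLess x y P R) s tr s' \<and> length tr \<le> steps n (IfLess x y P R) \<and>
      (\<forall>e\<in>set tr. small (limit n) e) \<and> bounded (limit n) s' \<and>
      (\<forall>z. z \<notin> writes (IfLess x y P R) \<longrightarrow> reg s' z = reg s z) \<and> Q s' (out @ output_stream tr)"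
      by (intro exI[of _ "test_event x y s # tr"] exI[of _ s'] conjI exec.IfTrue[OF True *(1)])
        (use * small_test[OF b] in auto)
  qed
next
  case False
  show ?thesis unfolding wp_def
  proof
    assume b: "bounded (limit n) s"
    with assms(2)[OF False] obtain tr s' where *: "exec R s tr s'" "length tr \<le> steps n R"
      "\<forall>e\<in>set tr. small (limit n) e" "bounded (limit n) s'"
      "\<forall>x. x \<notin> writes R \<longrightarrow> reg s' x = reg s x" "Q s' (out @ output_stream tr)"
      unfolding wp_def by blast
    show "\<exists>tr s'. exec (IfLess x y P R) s tr s' \<and> length tr \<le> steps n (IfLess x y P R) \<and>
      (\<forall>e\<in>set tr. small (limit n) e) \<and> bounded (limit n) s' \<and>
      (\<forall>z. z \<notin> writes (IfLess x y P R) \<longrightarrow> reg s' z = reg s z) \<and> Q s' (out @ output_stream tr)"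
      by (intro exI[of _ "test_event x y s # tr"] exI[of _ s'] conjI exec.IfFalse[OF False *(1)])
        (use * small_test[OF b] in auto)
  qed
qed

text \<open>The frame enters the consequence rule, so postconditions need not mention registers that
  \<open>P\<close> leaves alone.\<close>

lemma wp_mono:
  assumes "wp n P Q s out"
    and "\<And>s' out'. Q s' out' \<Longrightarrow> (\<And>x. x \<notin> writes P \<Longrightarrow> reg s' x = reg s x) \<Longrightarrow> R s' out'"
  shows "wp n P R s out"
  using assms unfolding wp_def by blast

text \<open>
  Registers 0 to 4 keep fixed values: 0, 1, the number \<open>n\<close> of vertices, and the addresses of the
  characteristic vectors of the current solution and of the next candidate.
\<close>

definition base :: "nat \<Rightarrow> nat" where
  "base n = 1 + n * n"

definition const_regs :: "nat \<Rightarrow> state \<Rightarrow> bool" where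
  "const_regs n s \<longleftrightarrow> reg s 0 = 0 \<and> reg s 1 = 1 \<and> reg s 2 = n \<and>
     reg s 3 = base n \<and> reg s 4 = base n + n"

lemma const_regs_frame:
  assumes "const_regs n s" and "\<And>x. x \<notin> W \<Longrightarrow> reg s' x = reg s x" and "W \<inter> {..<5} = {}"
  shows "const_regs n s'"
proof -
  have "reg s' x = reg s x" if "x < 5" for x
    using assms(2,3) that by auto
  then show ?thesis
    using assms(1) by (simp add: const_regs_def)
qed

section \<open>Counting loops\<close>

definition for_loop :: "nat \<Rightarrow> nat \<Rightarrow> prog \<Rightarrow> prog" where
  "for_loop x y P = Seq (Instr (Const x 0)) (WhileLess x y (Seq P (Instr (Add x x 1))))"

lemma writes_for_loop [simp]: "writes (for_loop x y P) = insert x (writes P)"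
  by (auto simp: for_loop_def)

text \<open>Induction on the \<open>k - j\<close> rounds that remain. The frame refers to the fixed
  state \<open>s0\<close>, so it can be chained over the rounds. The body has to establish the
  invariant for the state with the counter already raised, because \<open>Add x x 1\<close> runs
  after it.\<close>

lemma exec_while_count:
  assumes x: "5 \<le> x" "x \<le> 20" "x \<noteq> y" "x \<notin> writes P" "y \<notin> writes P" "writes P \<inter> {..<5} = {}"
    and step: "\<And>j s out. j < k \<Longrightarrow> I j s out \<Longrightarrow> reg s x = j \<Longrightarrow> reg s y = k \<Longrightarrow> const_regs n s \<Longrightarrow>
      (\<And>z. z \<notin> insert x (writes P) \<Longrightarrow> reg s z = reg s0 z) \<Longrightarrow>
      wp n P (\<lambda>s' out'. I (Suc j) (s'\<lparr>reg := (reg s')(x := Suc j)\<rparr>) out') s out"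
    and "k \<le> n"
  shows "\<lbrakk>j \<le> k; I j s out; reg s x = j; reg s y = k; const_regs n s; bounded (limit n) s;
      \<And>z. z \<notin> insert x (writes P) \<Longrightarrow> reg s z = reg s0 z\<rbrakk> \<Longrightarrow>
    \<exists>tr s'. exec (WhileLess x y (Seq P (Instr (Add x x 1)))) s tr s' \<and>
      length tr \<le> (k - j) * (1 + steps n (Seq P (Instr (Add x x 1)))) + 1 \<and>
      (\<forall>e\<in>set tr. small (limit n) e) \<and> bounded (limit n) s' \<and> const_regs n s' \<and>
      (\<forall>z. z \<notin> insert x (writes P) \<longrightarrow> reg s' z = reg s0 z) \<and> I k s' (out @ output_stream tr)"
proof (induction "k - j" arbitrary: j s out)
  case 0
  then have j: "j = k" by simp
  with 0 have "\<not> reg s x < reg s y" by simp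
  from exec.WhileFalse[OF this]
  show ?case
    using 0(3,6-8) j small_test[OF \<open>bounded (limit n) s\<close>]
    by (intro exI[of _ "[test_event x y s]"] exI[of _ s] conjI) auto
next
  case (Suc d)
  then have jk: "j < k" by simp
  let ?add = "Instr (Add x x 1)"
  let ?up = "\<lambda>s'. s'\<lparr>reg := (reg s')(x := Suc j)\<rparr>"
  have "wp n (Seq P ?add) (\<lambda>s' out'. I (Suc j) s' out' \<and> reg s' x = Suc j) s out"
  proof (intro wp_Seq, rule wp_mono[OF step[OF jk Suc.prems(2-5,7)]])
    fix s' out'
    assume I: "I (Suc j) (?up s') out'" and fr: "\<And>z. z \<notin> writes P \<Longrightarrow> reg s' z = reg s z"
    have rx: "reg s' x = j" "reg s' 1 = 1"
      using fr[OF x(4)] Suc.prems(3) const_regs_frame[OF Suc.prems(5) fr x(6)]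
      by (auto simp: const_regs_def)
    have "j + 1 \<le> limit n"
      using jk \<open>k \<le> n\<close> by (simp add: limit_def power2_eq_square algebra_simps)
    then show "wp n ?add (\<lambda>s' out'. I (Suc j) s' out' \<and> reg s' x = Suc j) s' out'"
      by (intro wp_Instr) (use rx I le_limit[OF x(2)] in simp_all)
  qed simp
  then obtain tr s' where 1: "exec (Seq P ?add) s tr s'" "length tr \<le> steps n (Seq P ?add)"
    "\<forall>e\<in>set tr. small (limit n) e" "bounded (limit n) s'"
    "\<And>z. z \<notin> writes (Seq P ?add) \<Longrightarrow> reg s' z = reg s z"
    "I (Suc j) s' (out @ output_stream tr)" "reg s' x = Suc j"
    using Suc.prems(6) unfolding wp_def by blast
  have w: "writes (Seq P ?add) = insert x (writes P)"
    by simp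
  have wW: "insert x (writes P) \<inter> {..<5} = {}"
    using x(1,6) by simp
  have c: "const_regs n s'"
    by (rule const_regs_frame[OF Suc.prems(5) _ wW]) (rule 1(5)[unfolded w])
  have y: "reg s' y = k"
    using 1(5)[of y] x Suc.prems(4) by auto
  have fr: "\<And>z. z \<notin> insert x (writes P) \<Longrightarrow> reg s' z = reg s0 z"
    by (rule trans[OF 1(5)[unfolded w] Suc.prems(7)])
  have d: "d = k - Suc j" and sj: "Suc j \<le> k"
    using Suc.hyps(2) jk by simp_all
  obtain tr' s'' where 2: "exec (WhileLess x y (Seq P ?add)) s' tr' s''"
      "length tr' \<le> (k - Suc j) * (1 + steps n (Seq P ?add)) + 1"
      "\<forall>e\<in>set tr'. small (limit n) e" "bounded (limit n) s''" "const_regs n s''"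
      "\<forall>z. z \<notin> insert x (writes P) \<longrightarrow> reg s'' z = reg s0 z"
      "I k s'' ((out @ output_stream tr) @ output_stream tr')"
    using Suc.hyps(1)[OF d sj 1(6) 1(7) y c 1(4) fr] by blast
  have "k - j = Suc (k - Suc j)"
    using jk by simp
  then have len: "1 + length tr + length tr' \<le> (k - j) * (1 + steps n (Seq P ?add)) + 1"
    using 1(2) 2(2) by simp
  have "reg s x < reg s y"
    using Suc.prems jk by simp
  from exec.WhileTrue[OF this 1(1) 2(1)] show ?case
    using 1(3) 2(3-7) len small_test[OF Suc.prems(6)]
    by (intro exI[of _ "test_event x y s # tr @ tr'"] exI[of _ s''] conjI) auto
qed

lemma wp_for_loop:
  assumes c: "const_regs n s"
    and x: "5 \<le> x" "x \<le> 20" "x \<noteq> y" "x \<notin> writes P" "y \<notin> writes P" "writes P \<inter> {..<5} = {}"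
    and k: "reg s y = k" "k \<le> n"
    and init: "I 0 (s\<lparr>reg := (reg s)(x := 0)\<rparr>) out"
    and step: "\<And>j s' out'. j < k \<Longrightarrow> I j s' out' \<Longrightarrow> reg s' x = j \<Longrightarrow> reg s' y = k \<Longrightarrow>
      const_regs n s' \<Longrightarrow> (\<And>z. z \<notin> insert x (writes P) \<Longrightarrow> reg s' z = reg s z) \<Longrightarrow>
      wp n P (\<lambda>s'' out''. I (Suc j) (s''\<lparr>reg := (reg s'')(x := Suc j)\<rparr>) out'') s' out'"
    and fin: "\<And>s' out'. I k s' out' \<Longrightarrow> const_regs n s' \<Longrightarrow>
      (\<And>z. z \<notin> insert x (writes P) \<Longrightarrow> reg s' z = reg s z) \<Longrightarrow> Q s' out'"
  shows "wp n (for_loop x y P) Q s out"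
  unfolding for_loop_def
proof (rule wp_Seq, rule wp_Instr)
  let ?s = "s\<lparr>reg := (reg s)(x := 0)\<rparr>"
  let ?w = "WhileLess x y (Seq P (Instr (Add x x 1)))"
  show "fits (limit n) (Const x 0) s"
    using le_limit[OF x(2)] by simp
  have c': "const_regs n ?s"
    by (rule const_regs_frame[OF c, of "{x}"]) (use x(1) in auto)
  have "wp n ?w Q ?s out"
    unfolding wp_def
  proof
    assume b: "bounded (limit n) ?s"
    have "reg ?s y = k"
      using k x(3) by simp
    note ex = exec_while_count[where I = I and s = ?s and ?s0.0 = s and j = 0,
        OF x step k(2) _ init _ this c' b]
    have "reg ?s z = reg s z" if "z \<notin> insert x (writes P)" for z
      using that by simp
    then obtain tr s' where *: "exec ?w ?s tr s'"
      "length tr \<le> k * (1 + steps n (Seq P (Instr (Add x x 1)))) + 1"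
      "\<forall>e\<in>set tr. small (limit n) e" "bounded (limit n) s'" "const_regs n s'"
      "\<And>z. z \<notin> insert x (writes P) \<Longrightarrow> reg s' z = reg s z" "I k s' (out @ output_stream tr)"
      using ex[unfolded diff_zero] by fastforce
    \<comment> \<open>\<open>steps\<close> charges \<open>n\<close> rounds to every loop, which
      \<open>k \<le> n\<close> justifies.\<close>
    have "length tr \<le> n * (1 + steps n (Seq P (Instr (Add x x 1)))) + 1"
      using *(2) mult_right_mono[OF k(2), of "1 + steps n (Seq P (Instr (Add x x 1)))"] by linarith
    moreover have "Q s' (out @ output_stream tr)"
      using fin[OF *(7,5,6)] .
    ultimately show "\<exists>tr s'. exec ?w ?s tr s' \<and> length tr \<le> steps n ?w \<and>
      (\<forall>e\<in>set tr. small (limit n) e) \<and> bounded (limit n) s' \<and>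
      (\<forall>z. z \<notin> writes ?w \<longrightarrow> reg s' z = reg ?s z) \<and> Q s' (out @ output_stream tr)"
      by (intro exI[of _ tr] exI[of _ s'] conjI) (use *(1-4,6) in auto)
  qed
  then show "wp n ?w Q (effect (Const x 0) s) (out @ output_stream (emitted (Const x 0) s))"
    by simp
qed

section \<open>Alliances on positions\<close>

context
  fixes n :: nat and adj :: "nat \<Rightarrow> nat \<Rightarrow> bool"
begin

definition defended :: "nat set \<Rightarrow> nat \<Rightarrow> bool" where
  "defended A v \<longleftrightarrow> card {u \<in> {..<n} - A. adj u v} \<le> card {u \<in> A. adj u v} + 1"

definition alliance :: "nat set \<Rightarrow> bool" where
  "alliance A \<longleftrightarrow> A \<subseteq> {..<n} \<and> (\<forall>v\<in>A. defended A v)"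

text \<open>Enlarging the set only moves neighbors of \<open>v\<close> from outside to inside. This
  is the source of closure under union.\<close>

lemma defended_mono:
  assumes "defended A v" and "A \<subseteq> B" and "B \<subseteq> {..<n}"
  shows "defended B v"
proof -
  have "finite B"
    using assms(3) finite_subset by blast
  then have "card {u \<in> A. adj u v} \<le> card {u \<in> B. adj u v}"
    using assms(2) by (intro card_mono) auto
  moreover have "card {u \<in> {..<n} - B. adj u v} \<le> card {u \<in> {..<n} - A. adj u v}"
    using assms(2) by (intro card_mono) auto
  ultimately show ?thesis
    using assms(1) by (simp add: defended_def)
qed

definition core :: "nat set \<Rightarrow> nat set" where
  "core X = \<Union>{B. alliance B \<and> B \<subseteq> X}"

lemma core_subset: "core X \<subseteq> X"
  by (auto simp: core_def)

lemma core_greatest: "alliance B \<Longrightarrow> B \<subseteq> X \<Longrightarrow> B \<subseteq> core X"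
  by (auto simp: core_def)

text \<open>Each member is defended in some alliance inside \<open>X\<close>, and stays so in the
  union of them.\<close>

lemma alliance_core: "alliance (core X)"
proof -
  have sub: "core X \<subseteq> {..<n}"
    by (auto simp: core_def alliance_def)
  moreover have "defended (core X) v" if "v \<in> core X" for v
  proof -
    from that obtain B where B: "alliance B" "B \<subseteq> X" "v \<in> B"
      by (auto simp: core_def)
    then have "defended B v"
      by (simp add: alliance_def)
    then show ?thesis
      by (rule defended_mono[OF _ core_greatest[OF B(1,2)] sub])
  qed
  ultimately show ?thesis
    by (simp add: alliance_def)
qed

lemma alliance_core_eq: "alliance M \<Longrightarrow> core X \<subseteq> M \<Longrightarrow> M \<subseteq> X \<Longrightarrow> M = core X"
  using core_greatest by blast

text \<open>Were \<open>v\<close> in the core, it would be defended there and hence in the larger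
  \<open>M\<close>. So undefended vertices may be removed in any order.\<close>

lemma core_remove:
  assumes "core X \<subseteq> M" and "M \<subseteq> {..<n}" and "\<not> defended M v"
  shows "core X \<subseteq> M - {v}"
  using defended_mono[OF _ assms(1,2)] assms alliance_core[of X] by (auto simp: alliance_def)

lemma alliance_all: "alliance {..<n}"
  by (simp add: alliance_def defended_def)

section \<open>The lexicographic order, larger vector first, and successors\<close>

definition precedes :: "nat set \<Rightarrow> nat set \<Rightarrow> bool" where
  "precedes A B \<longleftrightarrow> (\<exists>i. i \<in> A \<and> i \<notin> B \<and> A \<inter> {..<i} = B \<inter> {..<i})"

lemma precedes_irrefl: "\<not> precedes A A"
  by (auto simp: precedes_def)

lemma Int_lessThan_mono: "A \<inter> {..<i} = B \<inter> {..<i} \<Longrightarrow> j \<le> i \<Longrightarrow> A \<inter> {..<j} = B \<inter> {..<j}"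
  for i j :: nat
  by (drule arg_cong[of _ _ "\<lambda>C. C \<inter> {..<j}"]) (simp add: Int_assoc Int_absorb1)

lemma mem_Int_lessThan: "A \<inter> {..<i} = B \<inter> {..<i} \<Longrightarrow> j < i \<Longrightarrow> j \<in> A \<longleftrightarrow> j \<in> B"
  by (auto simp: set_eq_iff)

text \<open>The smaller of the two first differences is the first difference of \<open>A\<close> and
  \<open>C\<close>.\<close>

lemma precedes_trans:
  assumes "precedes A B" and "precedes B C"
  shows "precedes A C"
proof -
  obtain i j where i: "i \<in> A" "i \<notin> B" "A \<inter> {..<i} = B \<inter> {..<i}"
    and j: "j \<in> B" "j \<notin> C" "B \<inter> {..<j} = C \<inter> {..<j}"
    using assms by (auto simp: precedes_def)
  have "i \<noteq> j"
    using i j by auto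
  then consider "i < j" | "j < i"
    by linarith
  then show ?thesis
  proof cases
    case 1
    have "i \<notin> C" "A \<inter> {..<i} = C \<inter> {..<i}"
      using mem_Int_lessThan[OF j(3) 1] Int_lessThan_mono[OF j(3), of i] i 1 by auto
    with i(1) show ?thesis unfolding precedes_def by blast
  next
    case 2
    have "j \<in> A" "A \<inter> {..<j} = C \<inter> {..<j}"
      using mem_Int_lessThan[OF i(3) 2] Int_lessThan_mono[OF i(3), of j] j 2 by auto
    with j(2) show ?thesis unfolding precedes_def by blast
  qed
qed

text \<open>The first element of \<open>A - B\<close> is the first difference. Thus a set that is
  greatest for inclusion, as a core is, also comes first in the listing.\<close>

lemma psubset_precedes:
  assumes "B \<subset> A"
  shows "precedes A B"
proof -
  define i where "i = (LEAST i. i \<in> A - B)"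
  have "\<exists>i. i \<in> A - B"
    using assms by blast
  then have i: "i \<in> A - B"
    unfolding i_def by (rule LeastI_ex)
  have "j \<in> B" if "j \<in> A" "j < i" for j
    using not_less_Least[of j "\<lambda>i. i \<in> A - B"] that unfolding i_def by blast
  then have "A \<inter> {..<i} = B \<inter> {..<i}"
    using assms by blast
  with i show ?thesis
    unfolding precedes_def by blast
qed

text \<open>The outputs still due after \<open>A\<close>; this set serves in the specification of
  the main loop and, by its cardinality, as its induction measure.\<close>

definition later :: "nat set \<Rightarrow> nat set set" where
  "later A = {B. alliance B \<and> precedes A B}"

lemma finite_later: "finite (later A)"
  by (rule finite_subset[of _ "Pow {..<n}"]) (auto simp: later_def alliance_def)

definition candidate :: "nat set \<Rightarrow> nat \<Rightarrow> nat set" where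
  "candidate A i = core ((A \<inter> {..<i}) \<union> {i<..<n})"

text \<open>An exact test for the existence of an alliance that lacks \<open>i \<in> A\<close> and
  agrees with \<open>A\<close> below \<open>i\<close>: any such alliance lies in the candidate, and
  the candidate is then one itself.\<close>

definition extends :: "nat set \<Rightarrow> nat \<Rightarrow> bool" where
  "extends A i \<longleftrightarrow> i \<in> A \<and> A \<inter> {..<i} \<subseteq> candidate A i"

lemma later_extends:
  assumes "B \<in> later A" and "A \<subseteq> {..<n}"
  obtains k where "k < n" and "k \<in> A" and "k \<notin> B" and "A \<inter> {..<k} = B \<inter> {..<k}"
    and "extends A k" and "B \<subseteq> candidate A k"
proof -
  obtain k where B: "alliance B" and k: "k \<in> A" "k \<notin> B" "A \<inter> {..<k} = B \<inter> {..<k}"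
    using assms(1) by (auto simp: later_def precedes_def)
  have "B \<subseteq> (A \<inter> {..<k}) \<union> {k<..<n}"
  proof
    fix x assume "x \<in> B"
    then show "x \<in> (A \<inter> {..<k}) \<union> {k<..<n}"
      using k B by (cases x k rule: linorder_cases) (auto simp: alliance_def)
  qed
  then have "B \<subseteq> candidate A k"
    unfolding candidate_def by (rule core_greatest[OF B])
  with k assms(2) show thesis
    by (intro that[of k]) (auto simp: extends_def)
qed

text \<open>The test gives the prefix below \<open>i\<close>, and \<open>core_subset\<close>
  excludes \<open>i\<close> and further positions below it.\<close>

lemma extends_candidate:
  assumes "extends A i"
  shows "candidate A i \<inter> {..<i} = A \<inter> {..<i}" and "i \<notin> candidate A i"
    and "candidate A i \<in> later A"
proof -
  have sub: "candidate A i \<subseteq> (A \<inter> {..<i}) \<union> {i<..<n}"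
    unfolding candidate_def by (rule core_subset)
  then show eq: "candidate A i \<inter> {..<i} = A \<inter> {..<i}" and i: "i \<notin> candidate A i"
    using assms by (auto simp: extends_def)
  have "alliance (candidate A i)"
    unfolding candidate_def by (rule alliance_core)
  then show "candidate A i \<in> later A"
    using assms eq i by (auto simp: later_def precedes_def extends_def)
qed

lemma later_empty:
  assumes "A \<subseteq> {..<n}" and "\<And>k. k < n \<Longrightarrow> \<not> extends A k"
  shows "later A = {}"
  using later_extends[OF _ assms(1)] assms(2) by blast

text \<open>By maximality of \<open>i\<close>, a later \<open>B\<close> first differs from
  \<open>A\<close> at some \<open>k \<le> i\<close>. If \<open>k = i\<close>, then \<open>B\<close>
  is contained in the candidate; if \<open>k < i\<close>, the candidate still agrees with
  \<open>A\<close> up to and including \<open>k\<close> and so comes before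
  \<open>B\<close>.\<close>

lemma later_eq_insert:
  assumes "A \<subseteq> {..<n}" and "extends A i" and max: "\<And>k. i < k \<Longrightarrow> k < n \<Longrightarrow> \<not> extends A k"
  shows "later A = insert (candidate A i) (later (candidate A i))"
proof
  let ?M = "candidate A i"
  show "insert ?M (later ?M) \<subseteq> later A"
    using extends_candidate(3)[OF assms(2)] precedes_trans by (auto simp: later_def)
  show "later A \<subseteq> insert ?M (later ?M)"
  proof
    fix B assume B: "B \<in> later A"
    obtain k where k: "k < n" "extends A k" "B \<subseteq> candidate A k"
      and kB: "k \<in> A" "k \<notin> B" "A \<inter> {..<k} = B \<inter> {..<k}"
      using later_extends[OF B assms(1)] .
    from max[OF _ k(1)] k(2) have "k \<le> i"
      by (meson not_le)
    have "B = ?M \<or> precedes ?M B"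
    proof (cases "k = i")
      case True
      with k(3) psubset_precedes[of B ?M] show ?thesis by auto
    next
      case False
      with \<open>k \<le> i\<close> have "k < i" by simp
      have "k \<in> ?M" "?M \<inter> {..<k} = B \<inter> {..<k}"
        using mem_Int_lessThan[OF extends_candidate(1)[OF assms(2)] \<open>k < i\<close>] kB
          Int_lessThan_mono[OF extends_candidate(1)[OF assms(2)] \<open>k \<le> i\<close>] by auto
      with kB(2) show ?thesis unfolding precedes_def by blast
    qed
    with B show "B \<in> insert ?M (later ?M)"
      by (auto simp: later_def)
  qed
qed

lemma not_in_later: "A \<notin> later A"
  by (simp add: later_def precedes_irrefl)

text \<open>Every other alliance is a proper subset of the whole set and therefore comes
  later.\<close>

lemma alliances_eq: "{A. alliance A} = insert {..<n} (later {..<n})"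
  using psubset_precedes[of _ "{..<n}"] alliance_all by (auto simp: later_def alliance_def)

end

section \<open>The program\<close>

text \<open>
  Register 5 tells whether a next solution has been found, register 7 holds the position dropped
  from the current one, and register 16 the result of the check that the candidate contains all
  earlier positions. Registers 12 and 13 hold the two sides of the alliance condition.
\<close>

definition fill_program :: prog where
  "fill_program = for_loop 8 2 (Seq (Instr (Add 14 3 8)) (Instr (Store 14 1)))"

definition print_program :: prog where
  "print_program = for_loop 8 2
     (Seq (Instr (Add 14 3 8)) (Seq (Instr (Load 14 14)) (IfLess 0 14 (Instr (Write 8)) Skip)))"

definition prepare_program :: prog where
  "prepare_program = for_loop 8 2
     (Seq (Instr (Add 14 3 8)) (Seq (Instr (Load 15 14)) (Seq (Instr (Add 14 4 8))
       (IfLess 8 7 (Instr (Store 14 15)) (IfLess 7 8 (Instr (Store 14 1)) (Instr (Store 14 0)))))))"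

text \<open>Register 12 starts at 1 for the tolerance in the alliance condition, so undefended means
  that register 12 is less than register 13. The address \<open>u * n + v + 1\<close> skips the cell
  that holds \<open>n\<close>.\<close>

definition degree_program :: prog where
  "degree_program = Seq (Instr (Const 12 1)) (Seq (Instr (Const 13 0)) (for_loop 11 2
     (Seq (Instr (Mul 14 11 2)) (Seq (Instr (Add 14 14 10)) (Seq (Instr (Add 14 14 1))
       (Seq (Instr (Load 14 14)) (IfLess 0 14
         (Seq (Instr (Add 14 4 11)) (Seq (Instr (Load 14 14))
           (IfLess 0 14 (Instr (Add 12 12 1)) (Instr (Add 13 13 1)))))
         Skip)))))))"

text \<open>A removed vertex is cleared at once, so the remaining tests of the round already see the
  smaller set.\<close>

definition round_program :: prog where
  "round_program = for_loop 10 2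
     (Seq (Instr (Add 15 4 10)) (Seq (Instr (Load 14 15)) (IfLess 0 14
       (Seq degree_program (IfLess 12 13 (Seq (Instr (Add 15 4 10)) (Instr (Store 15 0))) Skip))
       Skip)))"

definition core_program :: prog where
  "core_program = for_loop 9 2 round_program"

definition check_program :: prog where
  "check_program = Seq (Instr (Const 16 1)) (for_loop 8 7
     (Seq (Instr (Add 14 3 8)) (Seq (Instr (Load 14 14)) (Seq (Instr (Add 15 4 8))
       (Seq (Instr (Load 15 15)) (IfLess 15 14 (Instr (Const 16 0)) Skip))))))"

definition copy_program :: prog where
  "copy_program = for_loop 8 2
     (Seq (Instr (Add 14 4 8)) (Seq (Instr (Load 15 14)) (Seq (Instr (Add 14 3 8))
       (Instr (Store 14 15)))))"

text \<open>\<open>for_loop\<close> counts upward but positions are tried downward, hence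
  \<open>n - k - 1\<close> for the counter \<open>k\<close> in register 6.\<close>

definition attempt_program :: prog where
  "attempt_program = Seq (Instr (Sub 7 2 6)) (Seq (Instr (Sub 7 7 1))
     (Seq (Instr (Add 14 3 7)) (Seq (Instr (Load 14 14)) (IfLess 0 14
       (Seq prepare_program (Seq core_program (Seq check_program
         (IfLess 0 16 (Seq copy_program (Instr (Const 5 1))) Skip))))
       Skip))))"

text \<open>Loops have no early exit, so the guard on register 5 makes the rounds after a success
  idle; the vector of \<open>A\<close> has been overwritten by then.\<close>

definition next_program :: prog where
  "next_program = Seq (Instr (Const 5 0)) (for_loop 6 2 (IfLess 5 1 attempt_program Skip))"

definition init_program :: prog where
  "init_program = Seq (Instr (Load 2 0)) (Seq (Instr (Const 1 1)) (Seq (Instr (Mul 3 2 2))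
     (Seq (Instr (Add 3 3 1)) (Seq (Instr (Add 4 3 2)) (Seq fill_program (Instr (Const 5 1)))))))"

definition main_program :: prog where
  "main_program = Seq init_program
     (WhileLess 0 5 (Seq print_program (Seq (Instr EndSolution) next_program)))"

section \<open>Correctness of the program\<close>

lemma le_limitI: "x \<le> n * n + 3 * n + 20 \<Longrightarrow> x \<le> limit n"
  by (simp add: limit_def power2_eq_square algebra_simps)

definition put :: "nat set \<Rightarrow> nat \<Rightarrow> bool \<Rightarrow> nat set" where
  "put A j b = (if b then insert j A else A - {j})"

lemma put_Int_Suc:
  "A \<inter> {..<j} = T \<inter> {..<j} \<Longrightarrow> b \<longleftrightarrow> j \<in> T \<Longrightarrow> put A j b \<inter> {..<Suc j} = T \<inter> {..<Suc j}"
  by (auto simp: put_def lessThan_Suc)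

lemma card_filter_Suc:
  "card {u. u < Suc j \<and> P u} = card {u. u < j \<and> P u} + of_bool (P j)" for P :: "nat \<Rightarrow> bool"
proof -
  have "{u. u < Suc j \<and> P u} = (if P j then insert j {u. u < j \<and> P u} else {u. u < j \<and> P u})"
    by (auto simp: less_Suc_eq)
  then show ?thesis
    by simp
qed

lemma card_filter_le: "card {u. u < j \<and> P u} \<le> j" for P :: "nat \<Rightarrow> bool"
  using card_mono[of "{..<j}" "{u. u < j \<and> P u}"] by auto

context
  fixes n :: nat and adj :: "nat \<Rightarrow> nat \<Rightarrow> bool"
begin

text \<open>Row-major matrix behind the cell with \<open>n\<close>, then the two characteristic
  vectors. Elements from \<open>n\<close> on leave no trace, so the memory determines a set only up
  to its part below \<open>n\<close>.\<close>

definition memory :: "nat set \<Rightarrow> nat set \<Rightarrow> nat \<Rightarrow> nat" where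
  "memory A M a =
     (if a = 0 then n
      else if a < base n then of_bool (adj ((a - 1) div n) ((a - 1) mod n))
      else if a < base n + n then of_bool (a - base n \<in> A)
      else if a < base n + n + n then of_bool (a - (base n + n) \<in> M)
      else 0)"

lemma base_pos: "0 < base n"
  by (simp add: base_def)

lemma memory_adj: "u < n \<Longrightarrow> v < n \<Longrightarrow> memory A M (Suc (u * n + v)) = of_bool (adj u v)"
proof -
  assume "u < n" "v < n"
  then have "u * n + v < n * n"
    by (metis add_less_cancel_left add.commute less_le_trans mult_Suc mult_le_mono1 Suc_leI)
  with \<open>v < n\<close> show ?thesis
    by (simp add: memory_def base_def)
qed

lemma memory_A: "j < n \<Longrightarrow> memory A M (base n + j) = of_bool (j \<in> A)"
  using base_pos by (simp add: memory_def)

lemma memory_M: "j < n \<Longrightarrow> memory A M (base n + n + j) = of_bool (j \<in> M)"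
  using base_pos by (simp add: memory_def)

lemma memory_put_A: "j < n \<Longrightarrow> (memory A M)(base n + j := of_bool b) = memory (put A j b) M"
  using base_pos by (auto simp: memory_def put_def fun_eq_iff)

lemma memory_put_M: "j < n \<Longrightarrow> (memory A M)(base n + n + j := of_bool b) = memory A (put M j b)"
  using base_pos by (auto simp: memory_def put_def fun_eq_iff)

lemma memory_cong:
  assumes "A \<inter> {..<n} = A' \<inter> {..<n}" and "M \<inter> {..<n} = M' \<inter> {..<n}"
  shows "memory A M = memory A' M'"
proof -
  have "x \<in> A \<longleftrightarrow> x \<in> A'" "x \<in> M \<longleftrightarrow> x \<in> M'" if "x < n" for x
    using assms that by auto
  then show ?thesis
    by (auto simp: memory_def fun_eq_iff)
qed

definition good :: "nat set \<Rightarrow> nat set \<Rightarrow> state \<Rightarrow> bool" where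
  "good A M s \<longleftrightarrow> const_regs n s \<and> mem s = memory A M"

lemma goodD:
  assumes "good A M s"
  shows "reg s 0 = 0" "reg s (Suc 0) = Suc 0" "reg s 2 = n" "reg s 3 = base n" "reg s 4 = base n + n"
    "mem s = memory A M" "const_regs n s"
  using assms by (auto simp: good_def const_regs_def)

lemma good_reg [simp]:
  "5 \<le> x \<Longrightarrow> good A M (s\<lparr>reg := f(x := k)\<rparr>) \<longleftrightarrow> good A M (s\<lparr>reg := f\<rparr>)"
  "good A M (s\<lparr>reg := reg s\<rparr>) \<longleftrightarrow> good A M s"
  by (auto simp: good_def const_regs_def)

lemma in_limit:
  "j \<le> n \<Longrightarrow> base n + j \<le> limit n" "j \<le> n \<Longrightarrow> base n + n + j \<le> limit n"
  by (auto intro!: le_limitI simp: base_def)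

lemmas exec_intros = wp_Seq wp_Instr wp_If wp_Skip

text \<open>The common step of loops that overwrite a vector by the target \<open>T\<close>: after
  \<open>j\<close> rounds the two agree below \<open>j\<close>.\<close>

lemma good_put_A:
  assumes "const_regs n s" and "mem s = (memory A M)(base n + j := of_bool (j \<in> T))"
    and "j < n" and "A \<inter> {..<j} = T \<inter> {..<j}"
  shows "\<exists>A'. good A' M s \<and> A' \<inter> {..<Suc j} = T \<inter> {..<Suc j}"
proof -
  have "mem s = memory (put A j (j \<in> T)) M"
    unfolding assms(2) by (rule memory_put_A[OF assms(3)])
  then show ?thesis
    using assms(1) put_Int_Suc[OF assms(4) refl] by (auto simp: good_def)
qed

lemma good_put_M:
  assumes "const_regs n s" and "mem s = (memory A M)(base n + n + j := of_bool (j \<in> T))"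
    and "j < n" and "M \<inter> {..<j} = T \<inter> {..<j}"
  shows "\<exists>M'. good A M' s \<and> M' \<inter> {..<Suc j} = T \<inter> {..<Suc j}"
proof -
  have "mem s = memory A (put M j (j \<in> T))"
    unfolding assms(2) by (rule memory_put_M[OF assms(3)])
  then show ?thesis
    using assms(1) put_Int_Suc[OF assms(4) refl] by (auto simp: good_def)
qed

lemma good_cong_A: "good A M s \<Longrightarrow> A \<inter> {..<n} = A' \<inter> {..<n} \<Longrightarrow> good A' M s"
  unfolding good_def using memory_cong by metis

lemma good_cong_M: "good A M s \<Longrightarrow> M \<inter> {..<n} = M' \<inter> {..<n} \<Longrightarrow> good A M' s"
  unfolding good_def using memory_cong by metis

section \<open>Filling, copying, printing and comparing vectors\<close>

lemma wp_fill:
  assumes s: "good A M s"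
  shows "wp n fill_program (\<lambda>s' out'. good {..<n} M s' \<and> out' = out) s out"
  unfolding fill_program_def
proof (rule wp_for_loop[where k = n and
    I = "\<lambda>j s' out'. out' = out \<and> (\<exists>A. good A M s' \<and> A \<inter> {..<j} = {..<n} \<inter> {..<j})"],
    goal_cases)
  \<comment> \<open>The numbers are those of the premises of \<open>wp_for_loop\<close>: 10 is the
    start of the invariant, 11 its preservation, 12 its use at the end.\<close>
  case (11 j s' out')
  from 11(2) obtain A where A: "good A M s'" "A \<inter> {..<j} = {..<n} \<inter> {..<j}"
    by blast
  note * = goodD[OF A(1)] 11(3)
  show ?case
    using 11(1,2)
    by (intro exec_intros conjI good_put_A[OF _ _ _ A(2)])
      (auto simp: * in_limit le_limit const_regs_def)
qed (use s in \<open>auto simp: goodD intro: good_cong_A\<close>)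

lemma wp_copy:
  assumes s: "good A M s" and M: "M \<subseteq> {..<n}"
  shows "wp n copy_program (\<lambda>s' out'. good M M s' \<and> out' = out) s out"
  unfolding copy_program_def
proof (rule wp_for_loop[where k = n and
    I = "\<lambda>j s' out'. out' = out \<and> (\<exists>A. good A M s' \<and> A \<inter> {..<j} = M \<inter> {..<j})"],
    goal_cases)
  case (11 j s' out')
  from 11(2) obtain A where A: "good A M s'" "A \<inter> {..<j} = M \<inter> {..<j}"
    by blast
  note * = goodD[OF A(1)] 11(3)
  show ?case
    using 11(1,2)
    by (intro exec_intros conjI good_put_A[OF _ _ _ A(2)])
      (auto simp: * in_limit le_limit memory_M const_regs_def)
qed (use s in \<open>auto simp: goodD intro: good_cong_A\<close>)

lemma wp_prepare:
  assumes s: "good A M s" and i: "reg s 7 = i"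
  shows "wp n prepare_program (\<lambda>s' out'. good A ((A \<inter> {..<i}) \<union> {i<..<n}) s' \<and> out' = out) s out"
    (is "wp n _ (\<lambda>s' out'. good A ?T s' \<and> _) s out")
  unfolding prepare_program_def
proof (rule wp_for_loop[where k = n and
    I = "\<lambda>j s' out'. out' = out \<and> (\<exists>M. good A M s' \<and> M \<inter> {..<j} = ?T \<inter> {..<j})"],
    goal_cases)
  case (11 j s' out')
  from 11(2) obtain M' where M': "good A M' s'" "M' \<inter> {..<j} = ?T \<inter> {..<j}"
    by blast
  have r7: "reg s' 7 = i"
    using 11(6)[of 7] i by simp
  note * = goodD[OF M'(1)] 11(3) r7
  show ?case
    using 11(1,2)
    by (intro exec_intros conjI good_put_M[OF _ _ _ M'(2)])
      (auto simp: * in_limit le_limit memory_A const_regs_def)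
qed (use s in \<open>auto simp: goodD intro: good_cong_M\<close>)

lemma wp_print:
  assumes s: "good A M s"
  shows "wp n print_program
    (\<lambda>s' out'. good A M s' \<and> out' = out @ map Some (filter (\<lambda>j. j \<in> A) [0..<n])) s out"
  unfolding print_program_def
proof (rule wp_for_loop[where k = n and
    I = "\<lambda>j s' out'. good A M s' \<and> out' = out @ map Some (filter (\<lambda>j. j \<in> A) [0..<j])"],
    goal_cases)
  case (11 j s' out')
  have g: "good A M s'" using 11(2) by blast
  note * = goodD[OF g] 11(3)
  show ?case
    using 11(1,2)
    by (intro exec_intros conjI) (auto simp: * in_limit le_limit memory_A)
qed (use s in \<open>auto simp: goodD\<close>)

lemma wp_check:
  assumes s: "good A M s" and i: "reg s 7 = i" "i \<le> n"
  shows "wp n check_program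
    (\<lambda>s' out'. good A M s' \<and> out' = out \<and> reg s' 16 = of_bool (A \<inter> {..<i} \<subseteq> M)) s out"
  unfolding check_program_def
proof (intro wp_Seq wp_Instr, goal_cases)
  case 2
  show ?case
  proof (rule wp_for_loop[where k = i and
      I = "\<lambda>j s' out'. good A M s' \<and> out' = out \<and> reg s' 16 = of_bool (A \<inter> {..<j} \<subseteq> M)"],
      goal_cases)
    case (11 j s' out')
    have g: "good A M s'" using 11(2) by blast
    note * = goodD[OF g] 11(3)
    show ?case
      using 11(1,2) i(2)
      by (intro exec_intros conjI) (auto simp: * in_limit le_limit memory_A memory_M lessThan_Suc)
  qed (use s i in \<open>auto simp: goodD\<close>)
qed (simp add: le_limit)

section \<open>Computing the core by removals\<close>

lemma wp_degree:
  assumes s: "good A M s" and v: "reg s 10 = v" "v < n" and M: "M \<subseteq> {..<n}"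
  shows "wp n degree_program (\<lambda>s' out'. good A M s' \<and> out' = out \<and>
     (reg s' 12 < reg s' 13 \<longleftrightarrow> \<not> defended n adj M v)) s out"
  unfolding degree_program_def
proof (intro wp_Seq wp_Instr, goal_cases)
  case 3
  show ?case
  proof (rule wp_for_loop[where k = n and
      I = "\<lambda>j s' out'. good A M s' \<and> out' = out \<and>
        reg s' 12 = Suc (card {u. u < j \<and> u \<in> M \<and> adj u v}) \<and>
        reg s' 13 = card {u. u < j \<and> u \<notin> M \<and> adj u v}"],
      goal_cases)
    case (11 j s' out')
    have g: "good A M s'" using 11(2) by blast
    have r10: "reg s' 10 = v"
      using 11(6)[of 10] v by simp
    have "j * n \<le> n * n"
      using 11(1) by simp
    then have lim: "j * n \<le> limit n" "j * n + v \<le> limit n" "Suc (j * n + v) \<le> limit n"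
      using v(2) by (intro le_limitI; linarith)+
    have card: "Suc (Suc (card {u. u < j \<and> P u})) \<le> limit n"
      "Suc (card {u. u < j \<and> P u}) \<le> limit n" for P
      using card_filter_le[of j P] 11(1) by (auto intro!: le_limitI)
    note * = goodD[OF g] 11(3) r10
    show ?case
      using 11(1,2) v(2)
      by (intro exec_intros conjI)
        (auto simp: * lim card in_limit le_limit memory_adj memory_M card_filter_Suc)
  next
    case (12 s' out')
    have 1: "{u. u < n \<and> u \<in> M \<and> adj u v} = {u \<in> M. adj u v}"
      using M by blast
    have 2: "{u. u < n \<and> u \<notin> M \<and> adj u v} = {u \<in> {..<n} - M. adj u v}"
      by blast
    from 12(1) show ?case
      unfolding 1 2 defended_def by (simp add: not_le)
  qed (use s v in \<open>auto simp: goodD\<close>)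
qed (simp_all add: le_limit)

text \<open>Until the first removal, all members of \<open>M0\<close> passed so far are defended in
  \<open>M0\<close>; from then on the cardinality has dropped. A whole round without removal has
  therefore verified an alliance.\<close>

lemma wp_round:
  assumes s: "good A M0 s" and M0: "core n adj X \<subseteq> M0" "M0 \<subseteq> {..<n}"
  shows "wp n round_program (\<lambda>s' out'. out' = out \<and> (\<exists>M. good A M s' \<and> core n adj X \<subseteq> M \<and>
    M \<subseteq> M0 \<and> (alliance n adj M \<or> card M < card M0))) s out"
  unfolding round_program_def
proof (rule wp_for_loop[where k = n and
    I = "\<lambda>v s' out'. out' = out \<and> (\<exists>M. good A M s' \<and> core n adj X \<subseteq> M \<and> M \<subseteq> M0 \<and>
      (M = M0 \<and> (\<forall>w<v. w \<in> M0 \<longrightarrow> defended n adj M0 w) \<or> card M < card M0))"],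
    goal_cases)
  case (11 v s' out')
  from 11(2) obtain M where g: "good A M s'" and M: "core n adj X \<subseteq> M" "M \<subseteq> M0"
    "M = M0 \<and> (\<forall>w<v. w \<in> M0 \<longrightarrow> defended n adj M0 w) \<or> card M < card M0"
    by blast
  note * = goodD[OF g] 11(3)
  let ?s = "effect (Load 14 15) (effect (Add 15 4 10) s')"
  have Mn: "M \<subseteq> {..<n}"
    using M(2) M0(2) by blast
  have fin: "finite M0" "finite M"
    using M0(2) Mn finite_subset by blast+
  show ?case
  proof (intro wp_Seq wp_Instr wp_If, goal_cases)
    case 3
    then have v: "v \<in> M"
      using 11(1) by (simp add: * memory_M split: if_splits)
    show ?case
    proof (rule wp_mono[OF wp_degree[of A M _ v]], goal_cases)
      case (5 s'' out'')
      then have g'': "good A M s''" and out: "out'' = out" and r10: "reg s'' 10 = v"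
        and less: "reg s'' 12 < reg s'' 13 \<longleftrightarrow> \<not> defended n adj M v"
        using 11(2) * 5(2)[of 10] by (auto simp: degree_program_def)
      note ** = goodD[OF g''] r10
      have card: "card (M - {v}) < card M0"
        using card_mono[OF fin(1) M(2)] card_Diff1_less[OF fin(2) v] by linarith
      have put: "(memory A M)(base n + n + v := 0) = memory A (M - {v})"
        using memory_put_M[OF 11(1), of A M False] by (simp add: put_def)
      show ?case
        apply (intro exec_intros)
        subgoal using 11(1) by (simp add: ** in_limit le_limit)
        subgoal by simp
        subgoal
          using core_remove[OF M(1) Mn, of v] less M(2) card out
          by (intro conjI exI[of _ "M - {v}"]) (auto simp: good_def ** const_regs_def put)
        subgoal
          using less M g'' out by (intro conjI exI[of _ M]) (auto simp: less_Suc_eq)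
        done
    qed (use g 11(1) Mn in \<open>auto simp: *\<close>)
  next
    case 4
    then have "v \<notin> M"
      using 11(1) by (simp add: * memory_M split: if_splits)
    then show ?case
      using 11(2) M g by (intro wp_Skip conjI exI[of _ M]) (auto simp: less_Suc_eq)
  qed (use 11(1) in \<open>auto simp: * in_limit le_limit\<close>)
next
  case (12 s' out')
  from 12(1) obtain M where "good A M s'" "core n adj X \<subseteq> M" "M \<subseteq> M0" "out' = out"
    "M = M0 \<and> (\<forall>w<n. w \<in> M0 \<longrightarrow> defended n adj M0 w) \<or> card M < card M0"
    by blast
  moreover from this have "alliance n adj M \<or> card M < card M0"
    using M0(2) by (auto simp: alliance_def)
  ultimately show ?case
    by blast
qed (use s M0 in \<open>auto simp: goodD degree_program_def\<close>)

text \<open>A round either ends in an alliance or loses a vertex, so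
  \<open>card M + r \<le> n\<close> as long as no alliance is reached. After \<open>n\<close> rounds
  this leaves the empty set, which is an alliance as well.\<close>

lemma wp_core:
  assumes s: "good A X s" and X: "X \<subseteq> {..<n}"
  shows "wp n core_program (\<lambda>s' out'. out' = out \<and> good A (core n adj X) s') s out"
  unfolding core_program_def
proof (rule wp_for_loop[where k = n and
    I = "\<lambda>r s' out'. out' = out \<and> (\<exists>M. good A M s' \<and> core n adj X \<subseteq> M \<and> M \<subseteq> X \<and>
      (alliance n adj M \<or> card M + r \<le> n))"],
    goal_cases)
  case (11 r s' out')
  from 11(2) obtain M where g: "good A M s'" and M: "core n adj X \<subseteq> M" "M \<subseteq> X"
    "alliance n adj M \<or> card M + r \<le> n" and out: "out' = out"
    by blast
  show ?case
  proof (rule wp_mono[OF wp_round[OF g M(1)]], goal_cases)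
    case (2 s'' out'')
    then obtain M' where M': "good A M' s''" "core n adj X \<subseteq> M'" "M' \<subseteq> M"
      "alliance n adj M' \<or> card M' < card M"
      by blast
    have "alliance n adj M' \<or> card M' + Suc r \<le> n"
    proof (cases "alliance n adj M")
      case True
      \<comment> \<open>An alliance inside \<open>X\<close> lies in the core, which no round
        diminishes.\<close>
      then have "M' = M"
        using core_greatest[OF True M(2)] M'(2,3) by blast
      with True show ?thesis by simp
    next
      case False
      with M(3) M'(4) show ?thesis by auto
    qed
    with M' M 2 out show ?case
      by (intro conjI exI[of _ M']) auto
  qed (use M X in auto)
next
  case (12 s' out')
  from 12(1) show ?case
  proof (elim conjE exE, goal_cases)
    case (1 M)
    have "finite M"
      using finite_subset[OF 1(4)] finite_subset[OF X] by simp
    with 1(5) have "alliance n adj M"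
      by (elim disjE) (simp_all add: alliance_def)
    then have "M = core n adj X"
      using 1(3,4) by (rule alliance_core_eq)
    with 1(1,2) show ?case by simp
  qed
next
  case 10
  have "card X \<le> n"
    using card_mono[OF _ X] by simp
  with s show ?case
    by (intro conjI exI[of _ X]) (auto simp: core_subset)
qed (use s in \<open>auto simp: goodD round_program_def degree_program_def\<close>)

end

section \<open>Finding the successor\<close>

lemma wp_attempt:
  assumes s: "good n adj A M s" and A: "A \<subseteq> {..<n}" and k: "reg s 6 = k" "k < n" and go: "reg s 5 = 0"
    and i: "i = n - Suc k"
  shows "wp n attempt_program (\<lambda>s' out'. out' = out \<and>
    (if extends n adj A i then reg s' 5 = 1 \<and> (\<exists>M. good n adj (candidate n adj A i) M s')
     else reg s' 5 = 0 \<and> (\<exists>M. good n adj A M s'))) s out"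
  unfolding attempt_program_def
proof (intro wp_Seq wp_Instr wp_If, goal_cases)
  have less: "i < n"
    using k(2) i by simp
  case 5
  then have iA: "i \<in> A"
    using less by (simp add: goodD[OF s] k(1) i[symmetric] memory_A split: if_splits)
  let ?s = "effect (Load 14 14) (effect (Add 14 3 7) (effect (Sub 7 7 1) (effect (Sub 7 2 6) s)))"
  have g: "good n adj A M ?s" and r: "reg ?s 7 = i" "reg ?s 5 = 0"
    using s by (simp_all add: goodD[OF s] k i go)
  show ?case
  proof (rule wp_mono[OF wp_prepare[of n adj A M _ i]], goal_cases)
    case (3 s1 out1)
    then have g1: "good n adj A ((A \<inter> {..<i}) \<union> {i<..<n}) s1" and o1: "out1 = out"
      and r1: "reg s1 7 = i" "reg s1 5 = 0"
      using r 3(2)[of 7] 3(2)[of 5] by (auto simp: prepare_program_def)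
    show ?case
    proof (rule wp_Seq, rule wp_mono[OF wp_core[OF g1]], goal_cases)
      case (2 s2 out2)
      then have g2: "good n adj A (candidate n adj A i) s2" and o2: "out2 = out"
        and r2: "reg s2 7 = i" "reg s2 5 = 0"
        using r1 o1 2(2)[of 7] 2(2)[of 5]
        by (auto simp: core_program_def round_program_def degree_program_def candidate_def)
      show ?case
      proof (rule wp_Seq, rule wp_mono[OF wp_check[OF g2 r2(1)]], goal_cases)
        case (2 s3 out3)
        then have g3: "good n adj A (candidate n adj A i) s3" and o3: "out3 = out"
          and r3: "reg s3 5 = 0" "reg s3 16 = of_bool (extends n adj A i)"
          using r2 o2 2(2)[of 5] iA by (auto simp: check_program_def extends_def)
        show ?case
        proof (intro wp_If wp_Seq, goal_cases)
          case 1
          then have ex: "extends n adj A i"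
            by (simp add: goodD[OF g3] r3 split: if_splits)
          have "candidate n adj A i \<subseteq> {..<n}"
            using alliance_core by (auto simp: candidate_def alliance_def)
          from wp_copy[OF g3 this, of out3] show ?case
            by (rule wp_mono) (use ex o3 in \<open>auto intro!: wp_Instr simp: le_limit\<close>)
        next
          case 2
          then have "\<not> extends n adj A i"
            by (simp add: goodD[OF g3] r3 split: if_splits)
          then show ?case
            using g3 o3 r3 by (intro wp_Skip) auto
        qed
      qed (use k(2) i in auto)
    qed (use A in auto)
  qed (use g r in auto)
next
  case 6
  have "i < n"
    using k(2) i by simp
  with 6 have "i \<notin> A"
    by (simp add: goodD[OF s] k(1) i[symmetric] memory_A split: if_splits)
  then have "\<not> extends n adj A i"
    by (simp add: extends_def)
  then show ?case
    using s by (intro wp_Skip) (auto simp: goodD[OF s] k i go)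
qed (use k(2) in \<open>auto simp: goodD[OF s] k le_limit in_limit\<close>)

text \<open>Positions are tried downward, so the first success is at the largest possible one, as
  \<open>later_eq_insert\<close> requires. If all fail, \<open>later_empty\<close> applies. The
  invariant refers to the original \<open>A\<close> even after the memory holds its
  successor.\<close>

lemma wp_next:
  assumes s: "good n adj A M s" and A: "A \<subseteq> {..<n}"
  shows "wp n next_program (\<lambda>s' out'. out' = out \<and>
    (reg s' 5 = 0 \<and> (\<exists>M. good n adj A M s') \<and> later n adj A = {} \<or>
     reg s' 5 = 1 \<and> (\<exists>B M. good n adj B M s' \<and> alliance n adj B \<and>
       later n adj A = insert B (later n adj B)))) s out"
  unfolding next_program_def
proof (intro wp_Seq wp_Instr, goal_cases)
  case 2
  show ?case
  proof (rule wp_for_loop[where k = n and I = "\<lambda>k s' out'. out' = out \<and>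
      (reg s' 5 = 0 \<and> (\<exists>M. good n adj A M s') \<and> (\<forall>i. n - k \<le> i \<longrightarrow> i < n \<longrightarrow> \<not> extends n adj A i) \<or>
       reg s' 5 = 1 \<and> (\<exists>i M. good n adj (candidate n adj A i) M s' \<and> extends n adj A i \<and>
         (\<forall>k>i. k < n \<longrightarrow> \<not> extends n adj A k)))"], goal_cases)
    case (11 k s' out')
    have out: "out' = out"
      using 11(2) by blast
    have r1: "reg s' 1 = 1"
      using 11(5) by (simp add: const_regs_def)
    show ?case
    proof (rule wp_If, goal_cases)
      case 1
      then have go: "reg s' 5 = 0"
        using r1 by simp
      with 11(2) obtain M' where M': "good n adj A M' s'"
        and none: "\<And>i. n - k \<le> i \<Longrightarrow> i < n \<Longrightarrow> \<not> extends n adj A i"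
        by auto
      define i where "i = n - Suc k"
      have ik: "n - k \<le> j \<longleftrightarrow> i < j" "n - Suc k \<le> j \<longleftrightarrow> i \<le> j" for j
        using 11(1) by (auto simp: i_def)
      show ?case
      proof (rule wp_mono[OF wp_attempt[OF M' A 11(3,1) go i_def]], goal_cases)
        case (1 s'' out'')
        show ?case
        proof (cases "extends n adj A i")
          case True
          with 1(1) none out show ?thesis
            by (auto simp: ik)
        next
          case False
          with none have "\<forall>j. n - Suc k \<le> j \<longrightarrow> j < n \<longrightarrow> \<not> extends n adj A j"
            unfolding ik by (metis le_neq_implies_less)
          with 1(1) False out show ?thesis
            by auto
        qed
      qed
    next
      case 2
      with 11(2) r1 show ?case
        by (intro wp_Skip) auto
    qed
  next
    case (12 s' out')
    from 12(1) have out: "out' = out"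
      by blast
    from 12(1) consider "reg s' 5 = 0" "\<exists>M. good n adj A M s'" "\<forall>i<n. \<not> extends n adj A i"
      | i M where "reg s' 5 = 1" "good n adj (candidate n adj A i) M s'" "extends n adj A i"
        "\<forall>k>i. k < n \<longrightarrow> \<not> extends n adj A k"
      by auto
    then show ?case
    proof cases
      case 1
      then show ?thesis
        using later_empty[OF A, of adj] out by blast
    next
      case 2
      have "alliance n adj (candidate n adj A i)"
        by (simp add: candidate_def alliance_core)
      moreover have "later n adj A = insert (candidate n adj A i) (later n adj (candidate n adj A i))"
        using later_eq_insert[OF A 2(3)] 2(4) by blast
      ultimately show ?thesis
        using 2(1,2) out by blast
    qed
  qed (use s in \<open>auto simp: goodD[OF s] const_regs_def attempt_program_def prepare_program_def
    core_program_def round_program_def degree_program_def check_program_def copy_program_def\<close>)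
qed (simp add: le_limit)

lemma wp_init:
  assumes s: "\<And>x. reg s x = 0" "mem s = memory n adj {} {}"
  shows "wp n init_program (\<lambda>s' out'. out' = out \<and> reg s' 5 = 1 \<and> good n adj {..<n} {} s') s out"
  unfolding init_program_def
proof (intro wp_Seq wp_Instr, goal_cases)
  case 6
  have "memory n adj {} {} 0 = n"
    by (simp add: memory_def)
  then have g: "good n adj {} {} (effect (Add 4 3 2) (effect (Add 3 3 1) (effect (Mul 3 2 2)
      (effect (Const 1 1) (effect (Load 2 0) s)))))"
    by (simp add: good_def const_regs_def s base_def)
  show ?case
    by (rule wp_mono[OF wp_fill[OF g]]) (auto intro!: wp_Instr simp: le_limit)
qed (auto simp: s memory_def le_limit intro!: le_limitI)

section \<open>Delay\<close>

text \<open>A period can straddle the border between two traces. Its part in the second trace lasts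
  at most this long, which makes delay bounds composable.\<close>

abbreviation lead_time :: "event list \<Rightarrow> nat" where
  "lead_time tr \<equiv> run_time (takeWhile (\<lambda>e. e \<noteq> Emit None) tr)"

lemma lead_time_append_Emit: "lead_time (tr @ Emit None # tr') \<le> run_time tr"
  by (induction tr) (auto simp: run_time_def)

text \<open>A period inside \<open>tr\<close> obeys the old bound; any other lies in
  \<open>q\<close> or consists of an end of \<open>q\<close> and a beginning of \<open>tr\<close>
  before its first marker.\<close>

lemma delay_at_most_append:
  assumes "delay_at_most tr D" and "run_time q + lead_time tr \<le> D"
  shows "delay_at_most (q @ tr) D"
  unfolding delay_at_most_def
proof (intro allI impI, elim conjE)
  fix us vs ws assume eq: "q @ tr = us @ vs @ ws" and vs: "Emit None \<notin> set vs"
  from eq consider (right) zs where "us = q @ zs" "tr = zs @ vs @ ws"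
    | (left) zs where "q = us @ zs" "vs @ ws = zs @ tr"
    by (auto simp: append_eq_append_conv2)
  then show "run_time vs \<le> D"
  proof cases
    case right
    with assms(1) vs show ?thesis
      unfolding delay_at_most_def by blast
  next
    case left
    from left(2) consider (inside) ys where "zs = vs @ ys" | (across) ys where "vs = zs @ ys" "tr = ys @ ws"
      by (auto simp: append_eq_append_conv2)
    then show ?thesis
    proof cases
      case inside
      with left(1) assms(2) show ?thesis by simp
    next
      case across
      have "takeWhile (\<lambda>e. e \<noteq> Emit None) tr = ys @ takeWhile (\<lambda>e. e \<noteq> Emit None) ws"
        unfolding across(2) using vs across(1) by (intro takeWhile_append2) auto
      with left(1) across(1) assms(2) show ?thesis by simp
    qed
  qed
qed

lemma delay_at_most_Emit:
  assumes "delay_at_most tr D"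
  shows "delay_at_most (Emit None # tr) D"
  unfolding delay_at_most_def
proof (intro allI impI, elim conjE)
  fix us vs ws assume eq: "Emit None # tr = us @ vs @ ws" and vs: "Emit None \<notin> set vs"
  show "run_time vs \<le> D"
  proof (cases us)
    case Nil
    with eq vs have "vs = []" by (cases vs) auto
    then show ?thesis by simp
  next
    case (Cons u us')
    with eq have "tr = us' @ vs @ ws"
      by simp
    with vs assms show ?thesis
      unfolding delay_at_most_def by blast
  qed
qed

lemma delay_at_most_Nil: "delay_at_most [] D"
  by (simp add: delay_at_most_def)

section \<open>The main loop\<close>

definition step_cost :: "nat \<Rightarrow> nat" where
  "step_cost n = 1 + 2 * limit n"

text \<open>One bound for all periods, each of which meets at most one run of each of the three
  programs; the 3 covers loop tests and the time of \<open>EndSolution\<close>.\<close>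

definition delay_bound :: "nat \<Rightarrow> nat" where
  "delay_bound n =
     (steps n init_program + steps n print_program + steps n next_program + 3) * step_cost n"

definition code :: "nat \<Rightarrow> nat set \<Rightarrow> nat list" where
  "code n A = filter (\<lambda>j. j \<in> A) [0..<n]"

lemma inj_on_code: "inj_on (code n) {A. alliance n adj A}"
proof (rule inj_onI)
  fix A B assume "A \<in> {A. alliance n adj A}" "B \<in> {A. alliance n adj A}" "code n A = code n B"
  moreover have "set (code n C) = C" if "alliance n adj C" for C
    using that by (auto simp: code_def alliance_def)
  ultimately show "A = B"
    by (metis mem_Collect_eq)
qed

lemma small_run_time:
  assumes "\<forall>e\<in>set tr. small (limit n) e" and "length tr \<le> k"
  shows "run_time tr \<le> k * step_cost n"
proof -
  have "run_time tr \<le> length tr * step_cost n"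
    unfolding step_cost_def by (rule run_time_le[OF assms(1)])
  also have "\<dots> \<le> k * step_cost n"
    using assms(2) by (intro mult_right_mono) auto
  finally show ?thesis .
qed

text \<open>Bounds the time that the main loop takes to complete its first output.\<close>

definition lead_bound :: "nat \<Rightarrow> nat" where
  "lead_bound n = (steps n print_program + 2) * step_cost n"

definition lists_alliances :: "nat \<Rightarrow> nat set set \<Rightarrow> event list \<Rightarrow> bool" where
  "lists_alliances n S tr \<longleftrightarrow>
     (\<forall>e\<in>set tr. small (limit n) e) \<and> outputs_exactly_once tr (code n ` S) \<and>
     delay_at_most tr (delay_bound n) \<and> lead_time tr \<le> lead_bound n"

abbreviation main_loop :: prog where
  "main_loop \<equiv> WhileLess 0 5 (Seq print_program (Seq (Instr EndSolution) next_program))"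

text \<open>The rounds are as many as the alliances, possibly exponentially many, so
  \<open>wp\<close> with its \<open>n\<close> rounds per loop cannot describe this loop. Its trace
  is built by induction on the number of solutions still due.\<close>

lemma exec_main_loop:
  assumes "good n adj A M s" and "reg s 5 = 1" and "alliance n adj A" and "bounded (limit n) s"
  shows "\<exists>tr s'. exec main_loop s tr s' \<and> lists_alliances n (insert A (later n adj A)) tr"
  using assms
proof (induction "card (later n adj A)" arbitrary: A M s rule: less_induct)
  case less
  note g = \<open>good n adj A M s\<close> and al = \<open>alliance n adj A\<close> and b = \<open>bounded (limit n) s\<close>
  have "A \<subseteq> {..<n}"
    using al by (simp add: alliance_def)
  obtain t1 s1 where t1: "exec print_program s t1 s1" "length t1 \<le> steps n print_program"
    "\<forall>e\<in>set t1. small (limit n) e" "bounded (limit n) s1" "good n adj A M s1"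
    "output_stream t1 = map Some (code n A)"
    using wp_print[OF g, of "[]"] b unfolding wp_def code_def by auto
  let ?w = "Work (cost EndSolution s1) (state_size s1)"
  have e: "exec (Instr EndSolution) s1 [?w, Emit None] s1"
    using exec.Instr[of EndSolution s1] by simp
  have w: "small (limit n) ?w"
    using small_cost[OF t1(4), of EndSolution] by simp
  obtain t2 s2 where t2: "exec next_program s1 t2 s2" "length t2 \<le> steps n next_program"
    "\<forall>e\<in>set t2. small (limit n) e" "bounded (limit n) s2" "output_stream t2 = []"
    and nxt: "reg s2 5 = 0 \<and> (\<exists>M. good n adj A M s2) \<and> later n adj A = {} \<or>
      reg s2 5 = 1 \<and> (\<exists>B M. good n adj B M s2 \<and> alliance n adj B \<and>
        later n adj A = insert B (later n adj B))"
    using wp_next[OF t1(5) \<open>A \<subseteq> {..<n}\<close>, of "[]"] t1(4) unfolding wp_def by auto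
  obtain t3 s3 where t3: "exec main_loop s2 t3 s3" "lists_alliances n (later n adj A) t3"
  proof -
    from nxt consider (stop) M' where "reg s2 5 = 0" "good n adj A M' s2" "later n adj A = {}"
      | (go) B M' where "reg s2 5 = 1" "good n adj B M' s2" "alliance n adj B"
        "later n adj A = insert B (later n adj B)"
      by blast
    then show thesis
    proof cases
      case stop
      then have "\<not> reg s2 0 < reg s2 5"
        by simp
      note ex = exec.WhileFalse[OF this]
      have sm: "\<forall>e\<in>set [test_event 0 5 s2]. small (limit n) e"
        using small_test[OF t2(4)] by simp
      have rt: "run_time [test_event 0 5 s2] \<le> 1 * step_cost n"
        by (rule small_run_time[OF sm]) simp
      have "outputs_exactly_once [test_event 0 5 s2] {}"
        by (auto simp: outputs_exactly_once_def intro: exI[of _ "[]"])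
      moreover have "delay_at_most ([test_event 0 5 s2] @ []) (delay_bound n)"
        by (rule delay_at_most_append[OF delay_at_most_Nil])
          (use rt in \<open>simp add: delay_bound_def algebra_simps\<close>)
      moreover have "lead_time [test_event 0 5 s2] \<le> lead_bound n"
        using rt by (simp add: lead_bound_def test_event_def)
      ultimately show thesis
        using sm stop(3) by (intro that[OF ex]) (simp add: lists_alliances_def)
    next
      case go
      \<comment> \<open>\<open>B\<close> itself is not in \<open>later n adj B\<close>, so exactly
        one solution fewer is due.\<close>
      have "card (later n adj B) < card (later n adj A)"
        unfolding go(4) using not_in_later[of B n adj] finite_later[of n adj B] by simp
      from less.hyps[OF this go(2,1,3) t2(4)] show thesis
        using that go(4) by auto
    qed
  qed
  \<comment> \<open>Everything before the marker that completes \<open>A\<close>: the loop test, the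
    printing and the time of \<open>EndSolution\<close>, hence the 2 in
    \<open>lead_bound\<close>.\<close>
  define q where "q = test_event 0 5 s # t1 @ [?w]"
  have "\<forall>e\<in>set q. small (limit n) e"
    using small_test[OF b] t1(3) w by (simp add: q_def)
  then have q: "run_time q \<le> lead_bound n"
    unfolding lead_bound_def by (rule small_run_time) (use t1(2) in \<open>simp add: q_def\<close>)
  have r2: "run_time t2 \<le> steps n next_program * step_cost n"
    by (rule small_run_time[OF t2(3,2)])
  let ?tr = "q @ Emit None # t2 @ t3"
  have lt: "reg s 0 < reg s 5"
    using less.prems(1,2) by (simp add: good_def const_regs_def)
  have "exec main_loop s ?tr s3"
    using exec.WhileTrue[OF lt exec.Seq[OF t1(1) exec.Seq[OF e t2(1)]] t3(1)] by (simp add: q_def)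
  moreover have "lists_alliances n (insert A (later n adj A)) ?tr"
    unfolding lists_alliances_def
  proof (intro conjI)
    show "\<forall>e\<in>set ?tr. small (limit n) e"
      using \<open>\<forall>e\<in>set q. small (limit n) e\<close> t2(3) t3(2) by (auto simp: lists_alliances_def)
    obtain ws where ws: "output_stream t3 = concat (map (\<lambda>w. map Some w @ [None]) ws)"
      "distinct ws" "set ws = code n ` later n adj A"
      using t3(2) by (auto simp: lists_alliances_def outputs_exactly_once_def)
    have "code n A \<notin> code n ` later n adj A"
    proof
      assume "code n A \<in> code n ` later n adj A"
      then obtain B where B: "B \<in> later n adj A" "code n A = code n B"
        by blast
      then have "alliance n adj B"
        by (simp add: later_def)
      then have "A = B"
        using inj_onD[OF inj_on_code B(2)] al by simp
      with B(1) show False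
        by (simp add: not_in_later)
    qed
    with ws t1(6) t2(5) show "outputs_exactly_once ?tr (code n ` insert A (later n adj A))"
      unfolding outputs_exactly_once_def by (intro exI[of _ "code n A # ws"]) (simp add: q_def)
    have D: "lead_bound n + steps n next_program * step_cost n \<le> delay_bound n"
      by (simp add: lead_bound_def delay_bound_def algebra_simps)
    have "delay_at_most (t2 @ t3) (delay_bound n)"
      using t3(2) r2 D by (intro delay_at_most_append) (auto simp: lists_alliances_def)
    then have "delay_at_most (Emit None # t2 @ t3) (delay_bound n)"
      by (rule delay_at_most_Emit)
    then show "delay_at_most ?tr (delay_bound n)"
      by (rule delay_at_most_append) (use q D in simp)
    show "lead_time ?tr \<le> lead_bound n"
      using lead_time_append_Emit[of q] q by (rule le_trans)
  qed
  ultimately show ?case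
    by blast
qed

lemma exec_main_program:
  assumes "\<And>x. reg s x = 0" and "mem s = memory n adj {} {}" and b: "bounded (limit n) s"
  shows "\<exists>tr s'. exec main_program s tr s' \<and> (\<forall>e\<in>set tr. small (limit n) e) \<and>
    outputs_exactly_once tr (code n ` {A. alliance n adj A}) \<and> delay_at_most tr (delay_bound n)"
proof -
  obtain t1 s1 where t1: "exec init_program s t1 s1" "length t1 \<le> steps n init_program"
    "\<forall>e\<in>set t1. small (limit n) e" "bounded (limit n) s1" "good n adj {..<n} {} s1"
    "output_stream t1 = []" "reg s1 5 = 1"
    using wp_init[OF assms(1,2), of "[]"] b unfolding wp_def by auto
  obtain t2 s2 where t2: "exec main_loop s1 t2 s2"
    "lists_alliances n (insert {..<n} (later n adj {..<n})) t2"
    using exec_main_loop[OF t1(5,7) alliance_all t1(4)] by blast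
  have "run_time t1 + lead_time t2 \<le> steps n init_program * step_cost n + lead_bound n"
    using small_run_time[OF t1(3,2)] t2(2) by (intro add_mono) (auto simp: lists_alliances_def)
  also have "\<dots> \<le> delay_bound n"
    by (simp add: lead_bound_def delay_bound_def algebra_simps)
  finally have "delay_at_most (t1 @ t2) (delay_bound n)"
    using t2(2) by (intro delay_at_most_append) (auto simp: lists_alliances_def)
  moreover have "exec main_program s (t1 @ t2) s2"
    unfolding main_program_def by (rule exec.Seq[OF t1(1) t2(1)])
  ultimately show ?thesis
    using t1(3,6) t2(2) unfolding alliances_eq
    by (intro exI[of _ "t1 @ t2"] exI[of _ s2]) (auto simp: lists_alliances_def outputs_exactly_once_def)
qed

section \<open>Graphs\<close>

definition adjacent :: "nat list \<Rightarrow> nat set set \<Rightarrow> nat \<Rightarrow> nat \<Rightarrow> bool" where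
  "adjacent vs E u v \<longleftrightarrow> {vs ! u, vs ! v} \<in> E"

section \<open>The input word\<close>

lemma length_concat_rows: "length [f u v. u \<leftarrow> us, v \<leftarrow> vs] = length us * length vs"
  by (induction us) auto

lemma nth_concat_rows:
  "i < length us * length vs \<Longrightarrow>
    [f u v. u \<leftarrow> us, v \<leftarrow> vs] ! i = f (us ! (i div length vs)) (vs ! (i mod length vs))"
proof (induction us arbitrary: i)
  case (Cons u us)
  show ?case
  proof (cases "i < length vs")
    case True
    then show ?thesis
      by (simp add: nth_append)
  next
    case False
    moreover have "0 < length vs"
      using Cons.prems by (cases vs) auto
    ultimately show ?thesis
      using Cons.IH[of "i - length vs"] Cons.prems
      by (simp add: nth_append not_less le_div_geq le_mod_geq less_diff_conv2 add.commute)
  qed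
qed simp

lemma length_encode_graph: "length (encode_graph (vs, E)) = 1 + length vs * length vs"
  by (simp add: encode_graph_def length_concat_rows)

lemma mem_init_state:
  "mem (init_state (encode_graph (vs, E))) = memory (length vs) (adjacent vs E) {} {}"
proof
  fix a
  show "mem (init_state (encode_graph (vs, E))) a = memory (length vs) (adjacent vs E) {} {} a"
  proof (cases a)
    case 0
    then show ?thesis
      by (simp add: init_state_def memory_def encode_graph_def)
  next
    case (Suc i)
    show ?thesis
    proof (cases "i < length vs * length vs")
      case True
      with Suc show ?thesis
        using nth_concat_rows[OF True, of "\<lambda>u v. if {u, v} \<in> E then 1 else 0 :: nat"]
        by (simp add: init_state_def memory_def base_def length_encode_graph adjacent_def)
          (simp add: encode_graph_def)
    next
      case False
      with Suc show ?thesis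
        by (simp add: init_state_def memory_def base_def length_encode_graph)
    qed
  qed
qed

lemma bounded_init_state: "bounded (limit (length vs)) (init_state (encode_graph (vs, E)))"
proof -
  let ?n = "length vs"
  have n: "?n \<le> limit ?n" "1 \<le> limit ?n" "?n * ?n < limit ?n"
    by (auto simp: limit_def power2_eq_square algebra_simps)
  have "memory ?n (adjacent vs E) {} {} a \<le> limit ?n" for a
    using n by (auto simp: memory_def)
  moreover have "memory ?n (adjacent vs E) {} {} a = 0" if "limit ?n < a" for a
    using n that by (auto simp: memory_def base_def)
  ultimately show ?thesis
    unfolding bounded_def mem_init_state by (simp add: init_state_def)
qed

lemma length_le_input_size: "length w \<le> input_size w"
  unfolding input_size_def by (induction w) auto

text \<open>Each matrix entry contributes at least 1 to the input size. Bounds polynomial in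
  \<open>n\<close> thereby become polynomial in the input size.\<close>

lemma input_size_encode_graph: "length vs \<le> input_size (encode_graph (vs, E))"
proof -
  have "length vs \<le> 1 + length vs * length vs"
    by (cases "length vs") auto
  then show ?thesis
    using length_le_input_size[of "encode_graph (vs, E)"] unfolding length_encode_graph by linarith
qed

section \<open>Positions versus vertices\<close>

definition positions :: "nat list \<Rightarrow> nat set \<Rightarrow> nat set" where
  "positions vs A = {i. i < length vs \<and> vs ! i \<in> A}"

text \<open>Distinctness makes the passage from positions to vertices injective, so it preserves
  neighbor counts.\<close>

lemma card_positions:
  assumes "distinct vs" and "A \<subseteq> set vs"
  shows "card {u \<in> positions vs A. adjacent vs E u v} = deg_in E A (vs ! v)"
proof -
  have img: "(!) vs ` {u \<in> positions vs A. adjacent vs E u v} = {u \<in> A. {u, vs ! v} \<in> E}"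
    using assms(2) by (auto simp: positions_def adjacent_def image_iff in_set_conv_nth)
      (metis subsetD in_set_conv_nth)
  have "inj_on ((!) vs) {u \<in> positions vs A. adjacent vs E u v}"
    using assms(1) by (auto simp: positions_def inj_on_def nth_eq_iff_index_eq)
  from card_image[OF this] show ?thesis
    unfolding deg_in_def img by simp
qed

lemma alliance_positions:
  assumes "distinct vs" and "A \<subseteq> set vs"
  shows "alliance (length vs) (adjacent vs E) (positions vs A) \<longleftrightarrow> defensive_alliance (set vs) E A"
proof -
  have "{..<length vs} - positions vs A = positions vs (set vs - A)"
    by (auto simp: positions_def)
  then have "defended (length vs) (adjacent vs E) (positions vs A) v \<longleftrightarrow>
      deg_in E (set vs - A) (vs ! v) \<le> deg_in E A (vs ! v) + 1" for v
    unfolding defended_def using card_positions[OF assms(1)] assms(2) by simp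
  moreover have "(\<forall>v\<in>positions vs A. P (vs ! v)) \<longleftrightarrow> (\<forall>v\<in>A. P v)" for P
    using assms(2) by (auto simp: positions_def) (metis subsetD in_set_conv_nth)
  moreover have "positions vs A \<subseteq> {..<length vs}"
    by (auto simp: positions_def)
  ultimately show ?thesis
    using assms(2) unfolding alliance_def defensive_alliance_def by simp
qed

lemma code_positions: "code (length vs) (positions vs A) = encode_vertex_set vs A"
  unfolding code_def encode_vertex_set_def by (rule filter_cong) (auto simp: positions_def)

lemma positions_image:
  assumes "distinct vs" and "B \<subseteq> {..<length vs}"
  shows "positions vs ((!) vs ` B) = B"
  using assms by (auto simp: positions_def image_iff nth_eq_iff_index_eq subset_iff)

lemma defensive_alliances_eq:
  assumes "distinct vs"
  shows "defensive_alliances (vs, E) = code (length vs) ` {A. alliance (length vs) (adjacent vs E) A}"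
proof -
  have "{A. alliance (length vs) (adjacent vs E) A} = positions vs ` {A. defensive_alliance (set vs) E A}"
  proof (intro equalityI subsetI)
    fix B assume B: "B \<in> {A. alliance (length vs) (adjacent vs E) A}"
    then have sub: "B \<subseteq> {..<length vs}"
      by (simp add: alliance_def)
    then have "(!) vs ` B \<subseteq> set vs"
      by auto
    from alliance_positions[OF assms this, of E] B
    have "defensive_alliance (set vs) E ((!) vs ` B)"
      by (simp add: positions_image[OF assms sub])
    then show "B \<in> positions vs ` {A. defensive_alliance (set vs) E A}"
      using positions_image[OF assms sub] by (metis imageI mem_Collect_eq)
  next
    fix B assume "B \<in> positions vs ` {A. defensive_alliance (set vs) E A}"
    then obtain A where A: "defensive_alliance (set vs) E A" "B = positions vs A"
      by blast
    moreover from A(1) have "A \<subseteq> set vs"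
      by (simp add: defensive_alliance_def)
    ultimately show "B \<in> {A. alliance (length vs) (adjacent vs E) A}"
      using alliance_positions[OF assms] by simp
  qed
  then show ?thesis
    by (simp add: defensive_alliances_def image_image code_positions)
qed

section \<open>Polynomial bounds\<close>

lemma poly_nat_mono:
  fixes p :: "nat poly"
  assumes "m \<le> n"
  shows "poly p m \<le> poly p n"
  by (induction p) (auto intro!: mult_mono simp: assms)

lemma limit_poly: "limit n = poly ([:20, 1:] ^ 2) n"
  by (simp add: limit_def poly_power add.commute)

lemma delay_bound_poly: "\<exists>p. \<forall>n. delay_bound n = poly p n"
proof -
  obtain p1 p2 p3 where "\<And>n. steps n init_program = poly p1 n" "\<And>n. steps n print_program = poly p2 n"
    "\<And>n. steps n next_program = poly p3 n"
    using steps_poly by meson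
  then have "delay_bound n = poly ((p1 + p2 + p3 + 3) * (1 + 2 * [:20, 1:] ^ 2)) n" for n
    by (simp add: delay_bound_def step_cost_def limit_poly)
  then show ?thesis
    by blast
qed

lemma exec_main_program_graph:
  assumes "x \<in> graph_instances"
  defines "n \<equiv> length (fst x)"
  shows "\<exists>tr s. exec main_program (init_state (encode_graph x)) tr s \<and>
    (\<forall>e\<in>set tr. small (limit n) e) \<and> outputs_exactly_once tr (defensive_alliances x) \<and>
    delay_at_most tr (delay_bound n)"
proof -
  obtain vs E where x: "x = (vs, E)" and vs: "distinct vs"
    using assms(1) by (auto simp: graph_instances_def)
  have "\<And>y. reg (init_state (encode_graph (vs, E))) y = 0"
    by (simp add: init_state_def)
  from exec_main_program[OF this mem_init_state bounded_init_state] show ?thesis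
    by (simp add: x n_def defensive_alliances_eq[OF vs])
qed

theorem theorem7:
  "\<exists>P. enumerates P graph_instances encode_graph defensive_alliances \<and>
       polynomial_delay P graph_instances encode_graph \<and>
       polynomial_space P graph_instances encode_graph"
proof (intro exI conjI)
  show "enumerates main_program graph_instances encode_graph defensive_alliances"
    unfolding enumerates_def using exec_main_program_graph by blast
next
  obtain p where p: "\<And>n. delay_bound n = poly p n"
    using delay_bound_poly by blast
  show "polynomial_delay main_program graph_instances encode_graph"
    unfolding polynomial_delay_def
  proof (intro exI[of _ p] ballI)
    fix x assume x: "x \<in> graph_instances"
    have "delay_bound (length (fst x)) \<le> poly p (input_size (encode_graph x))"
      unfolding p using input_size_encode_graph by (intro poly_nat_mono) (metis prod.collapse)
    then show "\<exists>tr s. exec main_program (init_state (encode_graph x)) tr s \<and>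
        delay_at_most tr (poly p (input_size (encode_graph x)))"
      using exec_main_program_graph[OF x] unfolding delay_at_most_def by (meson le_trans)
  qed
next
  \<comment> \<open>The bound of \<open>bounded_state_size\<close> with \<open>limit\<close> written
    as a polynomial.\<close>
  define p :: "nat poly" where "p = 2 * ([:20, 1:] ^ 2 + 1) * (1 + 2 * [:20, 1:] ^ 2)"
  show "polynomial_space main_program graph_instances encode_graph"
    unfolding polynomial_space_def
  proof (intro exI[of _ p] ballI)
    fix x assume x: "x \<in> graph_instances"
    let ?n = "length (fst x)"
    have "2 * (limit ?n + 1) * (1 + 2 * limit ?n) = poly p ?n"
      by (simp add: p_def limit_poly)
    also have "\<dots> \<le> poly p (input_size (encode_graph x))"
      using input_size_encode_graph by (intro poly_nat_mono) (metis prod.collapse)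
    finally have le: "2 * (limit ?n + 1) * (1 + 2 * limit ?n) \<le> poly p (input_size (encode_graph x))" .
    have "bounded (limit ?n) (init_state (encode_graph x))"
      using bounded_init_state by (metis prod.collapse)
    from le_trans[OF bounded_state_size[OF this] le]
    have init: "state_size (init_state (encode_graph x)) \<le> poly p (input_size (encode_graph x))" .
    have small: "m \<le> poly p (input_size (encode_graph x))" if "small (limit ?n) (Work t m)" for t m
      using that le unfolding small_def by simp
    from exec_main_program_graph[OF x] obtain tr s where
      "exec main_program (init_state (encode_graph x)) tr s" "\<forall>e\<in>set tr. small (limit ?n) e"
      by blast
    then show "\<exists>tr s. exec main_program (init_state (encode_graph x)) tr s \<and>
        state_size (init_state (encode_graph x)) \<le> poly p (input_size (encode_graph x)) \<and>
        (\<forall>t m. Work t m \<in> set tr \<longrightarrow> m \<le> poly p (input_size (encode_graph x)))"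
      using init small by blast
  qed
qed

end
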